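(* Consider the multi-period inventory system with Markov-modulated demand and state-dependent base-stock policies described in the context, and suppose assumptions (A1)–(A4) there hold. Then the policy gradient objective function $l$ satisfies the PŁK condition on $\Theta$ with PŁK constant $$\mu_l=\frac{\min_{t\in[T]}\{h_t+b_t\}^3\,\mu_D^3\,\alpha^8\,\min_{i\in\mathcal I}\{\nu_i\}^3}{e\,L_D^2\,\max_{t\in[T]}\{\max\{h_t,b_t\}\}^2\,T^4}.$$ More specifically, $$l(\theta)-l(\theta^* )\le\frac1{2\mu_l}\min_{g\in N_\Theta(\theta)}\|\nabla l(\theta)+g\|_2^2\qquad\forall\theta\in\Theta.$$
   Context: Inventory model with Markov-modulated demand: $[T]=\{1,\dots,T\}$. The world state $i_t$ follows an exogenous time-homogeneous Markov chain on a finite set $\mathcal I$ with transition probabilities $p(j|i)$ and $i_1\sim\nu$, where $\nu$ is a stationary distribution of the chain (so $i_t\sim\nu$ for all $t$). The initial inventory $x_1\in(-\infty,B]$ has CDF $\rho$. In world state $i_t$ the (nonnegative) demand $D_t$ has CDF $P_D(\cdot|i_t)$; demands are correlated across periods only through the Markov chain, and $i_{t+1}\sim p(\cdot|i_t)$ and $D_t\sim P_D(\cdot|i_t)$ are independent given $i_t$. Parameters: base-stock levels $\theta_{t,i}$; $\Theta_t=\{\theta_t\in\mathbb R^{|\mathcal I|}:\theta_{t,i}\in[0,B]\ \forall i\in\mathcal I\}$ with $B\ge0$, $\Theta=\Theta_1\times\dots\times\Theta_T$. Policy: order $(\theta_{t,i_t}-x_t)^+$, so the inventory after ordering is $x_t\vee\theta_{t,i_t}$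 and $x_{t+1}=x_t\vee\theta_{t,i_t}-D_t$ (unmet demand is backlogged). Per-period cost $L_t(y|i)=\mathbb E_{D\sim P_D(\cdot|i)}[h_t(y-D)^++b_t(y-D)^-]$ with $h_t,b_t\ge0$, where $z^+=\max\{z,0\}$, $z^-=\max\{-z,0\}$. Objective $l(\theta)=\mathbb E[\sum_{t=1}^TL_t(x_t\vee\theta_{t,i_t}|i_t)\mid x_1\sim\rho,\,i_1\sim\nu]$. The policy class with $\theta\in\Theta$ is assumed to contain an optimal policy; $\theta^*$ denotes the optimal base-stock levels: with $V^*_{T+1}=0$, $f_t(y|i)=L_t(y|i)+\mathbb E_{i'\sim p(\cdot|i),D\sim P_D(\cdot|i)}[V^*_{t+1}(y-D,i')]$ and $V_t^*(x,i)=\min_{y\ge x}f_t(y|i)$, each $\theta^*_{t,i}$ is a minimizer of $f_t(\cdot|i)$. Assumptions. (A1) $x_1$ is independent of the Markov chain and of the demands. (A2) The CDF $\rho$ of $x_1$ is $L_\rho$-Lipschitz continuous and $P_D(\cdot|i)$ is $L_D$-Lipschitz continuous for all $i\in\mathcal I$. (A3) There is a constant $\alpha>0$ with $\rho(0)\ge\alpha$ and $P_D(B|i)\le1-\alpha$ for all $i\in\mathcal I$. (A4) The probability density functions of the demands at each period are uniformly bounded below by $\mu_D>0$ on $[0,B]$. $N_\Theta(\theta)=\{g:\langle g,\theta'-\theta\rangle\le0\ \forall\theta'\in\Theta\}$ is the normal cone; the PŁK condition on $\Theta$ with constant $\mu_l$ is the displayed inequality. *)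

theory Defs
  imports "HOL-Probability.Probability"
begin

definition normal_cone :: "'a::real_inner set \<Rightarrow> 'a \<Rightarrow> 'a set" where
  "normal_cone S x = {g. \<forall>x'\<in>S. g \<bullet> (x' - x) \<le> 0}"

text \<open>Polyak-Lojasiewicz-Kurdyka condition on \<open>S\<close>, with optimality gap measured from \<open>xopt\<close>.
  The vector \<open>G\<close> is the gradient of \<open>f\<close> as a function on the whole space, also when \<open>x\<close> lies on the
  boundary of \<open>S\<close>; existence of the gradient and attainment of the minimum over the normal cone
  are part of the condition.\<close>

definition PLK_condition :: "('a::real_inner \<Rightarrow> real) \<Rightarrow> 'a set \<Rightarrow> 'a \<Rightarrow> real \<Rightarrow> bool" where
  "PLK_condition f S xopt \<mu> \<longleftrightarrow> 0 < \<mu> \<and>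
     (\<forall>x\<in>S. \<exists>G g. GDERIV f x :> G \<and>
        is_arg_min (\<lambda>g. (norm (G + g))\<^sup>2) (\<lambda>g. g \<in> normal_cone S x) g \<and>
        f x - f xopt \<le> 1 / (2 * \<mu>) * (norm (G + g))\<^sup>2)"

text \<open>\<open>L\<^sub>t(y|i)\<close>, where \<open>dem i\<close> is the law of the demand in world state \<open>i\<close>, so that
  \<open>cdf (dem i)\<close> is \<open>P\<^sub>D(\<cdot>|i)\<close>.\<close>

definition stage_cost ::
  "(nat \<Rightarrow> real) \<Rightarrow> (nat \<Rightarrow> real) \<Rightarrow> ('i \<Rightarrow> real measure) \<Rightarrow> nat \<Rightarrow> real \<Rightarrow> 'i \<Rightarrow> real" where
  "stage_cost h b dem t y i = (\<integral>d. h t * max (y - d) 0 + b t * max (- (y - d)) 0 \<partial>dem i)"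

text \<open>\<open>V\<^sup>*\<^sub>t(x,i)\<close>, with \<open>p i\<close> the law of the next world state. The minimum over \<open>y \<ge> x\<close> is written as an
  infimum; costs are nonnegative, and the infimum is attained once \<open>f\<^sub>t(\<cdot>|i)\<close>, which is convex,
  has a minimizer.\<close>

function opt_value ::
  "nat \<Rightarrow> (nat \<Rightarrow> real) \<Rightarrow> (nat \<Rightarrow> real) \<Rightarrow> ('i \<Rightarrow> 'i pmf) \<Rightarrow> ('i \<Rightarrow> real measure) \<Rightarrow>
   nat \<Rightarrow> real \<Rightarrow> 'i \<Rightarrow> real" where
  "opt_value T h b p dem t x i =
    (if T < t then 0
     else (INF y\<in>{x..}. stage_cost h b dem t y i +
             measure_pmf.expectation (p i)
               (\<lambda>j. \<integral>d. opt_value T h b p dem (Suc t) (y - d) j \<partial>dem i)))"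
  by pat_completeness auto
termination
  by (relation "Wellfounded.measure (\<lambda>(T, h, b, p, dem, t, x, i). Suc T - t)") auto

declare opt_value.simps [simp del]

text \<open>\<open>f\<^sub>t(y|i)\<close>\<close>

definition opt_cost_to_go ::
  "nat \<Rightarrow> (nat \<Rightarrow> real) \<Rightarrow> (nat \<Rightarrow> real) \<Rightarrow> ('i \<Rightarrow> 'i pmf) \<Rightarrow> ('i \<Rightarrow> real measure) \<Rightarrow>
   nat \<Rightarrow> real \<Rightarrow> 'i \<Rightarrow> real" where
  "opt_cost_to_go T h b p dem t y i = stage_cost h b dem t y i +
     measure_pmf.expectation (p i)
       (\<lambda>j. \<integral>d. opt_value T h b p dem (Suc t) (y - d) j \<partial>dem i)"

text \<open>Inventory path \<open>x\<^sub>t\<close> under base-stock levels \<open>\<theta>\<close>, for given initial inventory \<open>x1\<close>, world states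
  \<open>s\<close> and demands \<open>d\<close>. Periods are numbered from 1; the value at 0 is a dummy.\<close>

fun inventory ::
  "(nat \<Rightarrow> 'i \<Rightarrow> real) \<Rightarrow> real \<Rightarrow> (nat \<Rightarrow> 'i) \<Rightarrow> (nat \<Rightarrow> real) \<Rightarrow> nat \<Rightarrow> real" where
  "inventory \<theta> x1 s d 0 = x1"
| "inventory \<theta> x1 s d (Suc t) =
     (if t = 0 then x1 else max (inventory \<theta> x1 s d t) (\<theta> t (s t)) - d t)"

text \<open>The policy parameter lives in \<open>real^'i^'t\<close>; a bijection \<open>tm\<close> from the periods \<open>{1..T}\<close> onto the
  finite type \<open>'t\<close> labels its blocks, so \<open>\<theta>\<^sub>t\<^sub>,\<^sub>i\<close> is \<open>\<theta> $ tm t $ i\<close>.\<close>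

definition base_stock_set :: "real \<Rightarrow> (real^'i^'t) set" where
  "base_stock_set B = {\<theta>. \<forall>t i. \<theta> $ t $ i \<in> {0..B}}"

definition policy_cost ::
  "nat \<Rightarrow> (nat \<Rightarrow> 't::finite) \<Rightarrow> (nat \<Rightarrow> real) \<Rightarrow> (nat \<Rightarrow> real) \<Rightarrow> ('i::finite \<Rightarrow> real measure) \<Rightarrow>
   'w measure \<Rightarrow> ('w \<Rightarrow> real) \<Rightarrow> (nat \<Rightarrow> 'w \<Rightarrow> 'i) \<Rightarrow> (nat \<Rightarrow> 'w \<Rightarrow> real) \<Rightarrow> real^'i^'t \<Rightarrow> real" where
  "policy_cost T tm h b dem M X1 S D \<theta> =
     (\<integral>\<omega>. (\<Sum>t = 1..T.
        stage_cost h b dem t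
          (max (inventory (\<lambda>t i. \<theta> $ tm t $ i) (X1 \<omega>) (\<lambda>t. S t \<omega>) (\<lambda>t. D t \<omega>) t) (\<theta> $ tm t $ S t \<omega>))
          (S t \<omega>)) \<partial>M)"

end

theory Submission
  imports Defs
begin

text \<open>For a fixed policy \<open>\<theta>\<close> let \<open>f\<^sub>t(y|i)\<close> be the expected cost from period \<open>t\<close> on when \<open>t\<close> starts with inventory
  \<open>y\<close> after ordering and \<open>\<theta>\<close> is followed afterwards. Telescoping gives the performance difference
  \<open>l(\<theta>') - l(\<theta>) = \<Sum>\<^sub>t E[f\<^sub>t(x'\<^sub>t \<or> \<theta>'\<^sub>t) - f\<^sub>t(x'\<^sub>t \<or> \<theta>\<^sub>t)]\<close> along the path \<open>x'\<close> of \<open>\<theta>'\<close>. For \<open>\<theta>'\<close> near \<open>\<theta>\<close> it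
  yields the partial derivatives \<open>P(i\<^sub>t = i, x\<^sub>t \<le> \<theta>\<^sub>t\<^sub>,\<^sub>i) f\<^sub>t'(\<theta>\<^sub>t\<^sub>,\<^sub>i|i)\<close>, whose first factor is at least \<open>\<alpha> \<nu>\<^sub>i\<close>.
  Hence a small projected gradient makes every level \<open>\<theta>\<^sub>t\<^sub>,\<^sub>i\<close> almost stationary for \<open>f\<^sub>t(\<cdot>|i)\<close>. Although \<open>f\<^sub>t\<close>
  is not convex, its slope is then increasing at rate \<open>(h\<^sub>t + b\<^sub>t) \<mu>\<^sub>D\<close> up to an error that is the sum of the later
  stationarity errors, so each term of the performance difference towards any \<open>\<theta>'\<close> in the parameter set is
  quadratically small. This gives the larger constant \<open>min(h + b) \<mu>\<^sub>D \<alpha>\<^sup>2 min \<nu>\<^sup>2 / T\<^sup>2\<close>; optimality of \<open>\<theta>\<^sup>*\<close> only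
  enters, in the last period, through \<open>max(h, b) \<ge> \<alpha> min(h + b)\<close>, when comparing it with \<open>\<mu>\<^sub>l\<close>.\<close>

section \<open>Expectations and one-dimensional descent\<close>

lemma (in prob_space) prob_eq_sum_fibres:
  fixes Y :: "'a \<Rightarrow> 'i::finite"
  assumes Y[measurable]: "Y \<in> measurable M (count_space UNIV)" and E[measurable]: "{\<omega> \<in> space M. P \<omega>} \<in> events"
  shows "prob {\<omega> \<in> space M. P \<omega>} = (\<Sum>j\<in>UNIV. prob {\<omega> \<in> space M. P \<omega> \<and> Y \<omega> = j})"
proof -
  have "{\<omega> \<in> space M. P \<omega>} = (\<Union>j. {\<omega> \<in> space M. P \<omega> \<and> Y \<omega> = j})" by auto
  also have "prob \<dots> = (\<Sum>j\<in>UNIV. prob {\<omega> \<in> space M. P \<omega> \<and> Y \<omega> = j})"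
    by (rule finite_measure_finite_Union) (auto simp: disjoint_family_on_def)
  finally show ?thesis .
qed

lemma (in prob_space) expectation_eq_sum_fibres:
  fixes Y :: "'a \<Rightarrow> 'i::finite" and f :: "'a \<Rightarrow> real"
  assumes [measurable]: "Y \<in> measurable M (count_space UNIV)" and "integrable M f"
  shows "expectation f = (\<Sum>j\<in>UNIV. expectation (\<lambda>\<omega>. indicator {\<omega>. Y \<omega> = j} \<omega> * f \<omega>))"
proof -
  have "expectation f = expectation (\<lambda>\<omega>. \<Sum>j\<in>UNIV. indicator {\<omega>. Y \<omega> = j} \<omega> * f \<omega>)"
    by (rule Bochner_Integration.integral_cong) (auto simp: indicator_def if_distrib[where f="\<lambda>x. x * _"] cong: if_cong)
  also have "\<dots> = (\<Sum>j\<in>UNIV. expectation (\<lambda>\<omega>. indicator {\<omega>. Y \<omega> = j} \<omega> * f \<omega>))"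
  proof (rule Bochner_Integration.integral_sum)
    fix j
    have "integrable M (\<lambda>\<omega>. indicator {\<omega> \<in> space M. Y \<omega> = j} \<omega> *\<^sub>R f \<omega>)"
      by (rule integrable_mult_indicator) (use assms in auto)
    also have "?this \<longleftrightarrow> integrable M (\<lambda>\<omega>. indicator {\<omega>. Y \<omega> = j} \<omega> * f \<omega>)"
      by (rule Bochner_Integration.integrable_cong) (auto simp: indicator_def)
    finally show "integrable M (\<lambda>\<omega>. indicator {\<omega>. Y \<omega> = j} \<omega> * f \<omega>)" .
  qed
  finally show ?thesis .
qed

text \<open>Conditionally on \<open>E\<close>, the hypothesis makes \<open>Y\<close> have law \<open>N\<close> and be independent of \<open>X\<close>
  on \<open>F \<subseteq> E\<close>, an event of conditional probability \<open>\<kappa>\<close>.\<close>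

lemma (in prob_space) expectation_conditionally_indep:
  fixes X Y :: "'a \<Rightarrow> real" and \<phi> :: "real \<Rightarrow> real \<Rightarrow> real"
  assumes N: "real_distribution N" and [measurable]: "X \<in> borel_measurable M" "Y \<in> borel_measurable M"
    "{\<omega> \<in> space M. E \<omega>} \<in> events" "{\<omega> \<in> space M. F \<omega>} \<in> events" and "0 \<le> \<kappa>"
    and rect: "\<And>A C. A \<in> sets borel \<Longrightarrow> C \<in> sets borel \<Longrightarrow>
      prob {\<omega> \<in> space M. X \<omega> \<in> A \<and> Y \<omega> \<in> C \<and> F \<omega>} = prob {\<omega> \<in> space M. X \<omega> \<in> A \<and> E \<omega>} * \<kappa> * measure N C"
    and \<phi>[measurable]: "(\<lambda>(x, y). \<phi> x y) \<in> borel_measurable (borel \<Otimes>\<^sub>M borel)"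
    and bnd: "\<And>x y. \<bar>\<phi> x y\<bar> \<le> K"
  shows "expectation (\<lambda>\<omega>. indicator {\<omega>. F \<omega>} \<omega> * \<phi> (X \<omega>) (Y \<omega>))
    = \<kappa> * expectation (\<lambda>\<omega>. indicator {\<omega>. E \<omega>} \<omega> * (\<integral>y. \<phi> (X \<omega>) y \<partial>N))"
proof -
  interpret N: real_distribution N by fact
  \<comment> \<open>\<open>M1\<close> is the law of \<open>X\<close> on \<open>E\<close>,
    \<open>M2\<close> is \<open>N\<close> scaled to mass \<kappa>, and \<open>MF\<close> is the
    joint law of \<open>X\<close> and \<open>Y\<close> on \<open>F\<close>; none of them need have
    mass 1. The hypothesis on rectangles identifies \<open>MF\<close> with the product of the other
    two, and the claim becomes Fubini's theorem.\<close>
  define M1 where "M1 = distr (density M (indicator {\<omega> \<in> space M. E \<omega>})) borel X"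
  define M2 where "M2 = density N (\<lambda>_. ennreal \<kappa>)"
  define MF where "MF = distr (density M (indicator {\<omega> \<in> space M. F \<omega>})) (borel \<Otimes>\<^sub>M borel) (\<lambda>\<omega>. (X \<omega>, Y \<omega>))"
  have [measurable_cong, simp]: "sets M1 = sets borel" "sets M2 = sets borel" "sets MF = sets (borel \<Otimes>\<^sub>M borel)"
    by (auto simp: M1_def M2_def MF_def)
  have sp: "space M1 = UNIV" "space M2 = UNIV" by (auto simp: M1_def M2_def)
  have e1: "emeasure M1 A = ennreal (prob {\<omega> \<in> space M. X \<omega> \<in> A \<and> E \<omega>})" if [measurable]: "A \<in> sets borel" for A
  proof -
    have "emeasure M1 A = (\<integral>\<^sup>+\<omega>. indicator {\<omega> \<in> space M. X \<omega> \<in> A \<and> E \<omega>} \<omega> \<partial>M)"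
      unfolding M1_def by (subst emeasure_distr, simp, simp, subst emeasure_density, measurable)
        (intro nn_integral_cong, auto simp: indicator_def)
    then show ?thesis by (simp add: emeasure_eq_measure)
  qed
  have e2: "emeasure M2 C = ennreal (\<kappa> * measure N C)" if "C \<in> sets borel" for C
    using that by (simp add: M2_def emeasure_density N.emeasure_eq_measure nn_integral_cmult ennreal_mult' \<open>0 \<le> \<kappa>\<close>)
  have eF: "emeasure MF (A \<times> C) = ennreal (prob {\<omega> \<in> space M. X \<omega> \<in> A \<and> Y \<omega> \<in> C \<and> F \<omega>})"
    if [measurable]: "A \<in> sets borel" "C \<in> sets borel" for A C
  proof -
    have "emeasure MF (A \<times> C) = (\<integral>\<^sup>+\<omega>. indicator {\<omega> \<in> space M. X \<omega> \<in> A \<and> Y \<omega> \<in> C \<and> F \<omega>} \<omega> \<partial>M)"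
      unfolding MF_def by (subst emeasure_distr, simp, simp, subst emeasure_density, measurable)
        (intro nn_integral_cong, auto simp: indicator_def)
    then show ?thesis by (simp add: emeasure_eq_measure)
  qed
  have "emeasure M1 (space M1) \<noteq> \<infinity>" "emeasure M2 (space M2) \<noteq> \<infinity>" by (simp_all add: e1 e2 sp)
  then interpret M1: finite_measure M1 + M2: finite_measure M2
    using finite_measure.intro by (auto intro: finite_measureI)
  interpret P: pair_sigma_finite M1 M2 ..
  have MF: "M1 \<Otimes>\<^sub>M M2 = MF"
    by (rule pair_measure_eqI)
      (auto simp: e1 e2 eF rect M1.sigma_finite_measure_axioms M2.sigma_finite_measure_axioms
        ennreal_mult'[symmetric] \<open>0 \<le> \<kappa>\<close> mult.assoc cong: sets_pair_measure_cong)
  interpret PF: finite_measure "M1 \<Otimes>\<^sub>M M2"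
    by (rule finite_measure_pair_measure) (unfold_locales)
  have int: "integrable (M1 \<Otimes>\<^sub>M M2) (\<lambda>(x, y). \<phi> x y)"
    by (rule PF.integrable_const_bound[where B=K]) (auto simp: bnd)
  have "expectation (\<lambda>\<omega>. indicator {\<omega>. F \<omega>} \<omega> * \<phi> (X \<omega>) (Y \<omega>))
      = (\<integral>\<omega>. \<phi> (X \<omega>) (Y \<omega>) \<partial>density M (\<lambda>\<omega>. ennreal (indicator {\<omega> \<in> space M. F \<omega>} \<omega>)))"
    by (subst integral_density) (auto intro!: Bochner_Integration.integral_cong simp: indicator_def)
  also have "\<dots> = (\<integral>z. (case z of (x, y) \<Rightarrow> \<phi> x y) \<partial>MF)"
    unfolding MF_def by (subst integral_distr) (simp_all add: ennreal_indicator)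
  also have "\<dots> = (\<integral>x. (\<integral>y. \<phi> x y \<partial>M2) \<partial>M1)"
    unfolding MF[symmetric] using P.integral_fst'[OF int] by simp
  also have "\<dots> = (\<integral>x. \<kappa> * (\<integral>y. \<phi> x y \<partial>N) \<partial>M1)"
    unfolding M2_def by (subst integral_density) (auto simp: \<open>0 \<le> \<kappa>\<close>)
  also have "\<dots> = (\<integral>\<omega>. \<kappa> * (\<integral>y. \<phi> (X \<omega>) y \<partial>N) \<partial>density M (\<lambda>\<omega>. ennreal (indicator {\<omega> \<in> space M. E \<omega>} \<omega>)))"
    unfolding M1_def by (subst integral_distr) (simp_all add: ennreal_indicator)
  also have "\<dots> = \<kappa> * expectation (\<lambda>\<omega>. indicator {\<omega>. E \<omega>} \<omega> * (\<integral>y. \<phi> (X \<omega>) y \<partial>N))"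
    by (subst integral_density, simp, simp, simp, subst integral_mult_right_zero[symmetric])
      (intro Bochner_Integration.integral_cong, auto simp: indicator_def)
  finally show ?thesis .
qed

section \<open>Expectations of shifted functions\<close>

context real_distribution
begin

lemma expectation_shift_lipschitz:
  assumes lip: "K-lipschitz_on UNIV \<phi>" and int: "\<And>y. integrable M (\<lambda>d. \<phi> (y - d) :: real)"
  shows "K-lipschitz_on UNIV (\<lambda>y. expectation (\<lambda>d. \<phi> (y - d)))"
proof (rule lipschitz_onI)
  fix x y :: real
  have "\<bar>expectation (\<lambda>d. \<phi> (x - d)) - expectation (\<lambda>d. \<phi> (y - d))\<bar> = \<bar>expectation (\<lambda>d. \<phi> (x - d) - \<phi> (y - d))\<bar>"
    by (simp add: int)
  also have "\<dots> \<le> expectation (\<lambda>d. \<bar>\<phi> (x - d) - \<phi> (y - d)\<bar>)"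
    by (rule integral_abs_bound)
  also have "\<dots> \<le> expectation (\<lambda>d. K * \<bar>x - y\<bar>)"
  proof (rule integral_mono)
    show "\<bar>\<phi> (x - d) - \<phi> (y - d)\<bar> \<le> K * \<bar>x - y\<bar>" for d
      using lipschitz_onD[OF lip, of "x - d" "y - d"] by (simp add: dist_real_def)
  qed (auto simp: int)
  finally show "dist (expectation (\<lambda>d. \<phi> (x - d))) (expectation (\<lambda>d. \<phi> (y - d))) \<le> K * dist x y"
    using prob_space by (simp add: dist_real_def)
qed (rule lipschitz_on_nonneg[OF lip])

text \<open>Dominated convergence for difference quotients: the Lipschitz constant bounds them, and
  \<open>y - d\<close> meets the kink \<open>c\<close> for one value of \<open>d\<close> only, a
  null set. The limit also yields integrability of \<open>\<phi>'\<close>, so both claims come from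
  one statement about sequences.\<close>

lemma expectation_shift_deriv:
  fixes \<phi> \<phi>' :: "real \<Rightarrow> real"
  assumes lip: "K-lipschitz_on UNIV \<phi>" and int: "\<And>y. integrable M (\<lambda>d. \<phi> (y - d))"
    and deriv: "\<And>z. z \<noteq> c \<Longrightarrow> (\<phi> has_real_derivative \<phi>' z) (at z)"
    and [measurable]: "\<phi>' \<in> borel_measurable borel" and atomless: "\<And>x. prob {x} = 0"
  shows "integrable M (\<lambda>d. \<phi>' (y - d))" (is ?I)
    and "((\<lambda>y. expectation (\<lambda>d. \<phi> (y - d))) has_real_derivative expectation (\<lambda>d. \<phi>' (y - d))) (at y)" (is ?D)
proof -
  have [measurable]: "\<phi> \<in> borel_measurable borel"
    using lip by (intro borel_measurable_continuous_onI lipschitz_on_continuous_on)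
  have ne: "AE d in M. y - d \<noteq> c"
  proof (rule AE_I)
    show "emeasure M {y - c} = 0" using atomless[of "y - c"] by (simp add: emeasure_eq_measure)
  qed auto
  have main: "?I \<and> (\<lambda>n. expectation (\<lambda>d. (\<phi> (X n - d) - \<phi> (y - d)) / (X n - y))) \<longlonglongrightarrow> expectation (\<lambda>d. \<phi>' (y - d))"
    if X: "\<And>n. X n \<noteq> y" "X \<longlonglongrightarrow> y" for X
  proof -
    have lim: "AE d in M. (\<lambda>n. (\<phi> (X n - d) - \<phi> (y - d)) / (X n - y)) \<longlonglongrightarrow> \<phi>' (y - d)"
      using ne
    proof eventually_elim
      fix d assume "y - d \<noteq> c"
      then have "((\<lambda>z. (\<phi> z - \<phi> (y - d)) / (z - (y - d))) \<longlongrightarrow> \<phi>' (y - d)) (at (y - d))"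
        using deriv by (simp add: has_field_derivative_iff)
      then have "((\<lambda>z. (\<phi> z - \<phi> (y - d)) / (z - (y - d))) \<circ> (\<lambda>n. X n - d)) \<longlonglongrightarrow> \<phi>' (y - d)"
        using X unfolding tendsto_at_iff_sequentially
        by (elim allE[of _ "\<lambda>n. X n - d"]) (auto intro!: tendsto_intros)
      then show "(\<lambda>n. (\<phi> (X n - d) - \<phi> (y - d)) / (X n - y)) \<longlonglongrightarrow> \<phi>' (y - d)"
        by (simp add: comp_def)
    qed
    have bd: "AE d in M. norm ((\<phi> (X n - d) - \<phi> (y - d)) / (X n - y)) \<le> K" for n
    proof (rule AE_I2)
      fix d
      have "\<bar>\<phi> (X n - d) - \<phi> (y - d)\<bar> \<le> K * \<bar>X n - y\<bar>"
        using lipschitz_onD[OF lip, of "X n - d" "y - d"] by (simp add: dist_real_def)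
      then show "norm ((\<phi> (X n - d) - \<phi> (y - d)) / (X n - y)) \<le> K"
        using X(1)[of n] by (simp add: abs_divide field_simps)
    qed
    show ?thesis
      using integrable_dominated_convergence[OF _ _ _ lim bd] integral_dominated_convergence[OF _ _ _ lim bd]
      by simp
  qed
  show ?I
    \<comment> \<open>Any sequence that tends to \<open>y\<close> and avoids it would do
      here.\<close>
    using main[of "\<lambda>n. y + inverse (real (Suc n))"] LIMSEQ_inverse_real_of_nat_add[of y] by auto
  show ?D
    unfolding has_field_derivative_iff tendsto_at_iff_sequentially
  proof (intro allI impI)
    fix X assume "\<forall>i. X i \<in> UNIV - {y}" "X \<longlonglongrightarrow> y"
    then have "(\<lambda>n. expectation (\<lambda>d. (\<phi> (X n - d) - \<phi> (y - d)) / (X n - y))) \<longlonglongrightarrow> expectation (\<lambda>d. \<phi>' (y - d))"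
      using main[of X] by auto
    then show "((\<lambda>z. (expectation (\<lambda>d. \<phi> (z - d)) - expectation (\<lambda>d. \<phi> (y - d))) / (z - y)) \<circ> X)
        \<longlonglongrightarrow> expectation (\<lambda>d. \<phi>' (y - d))"
      by (simp add: comp_def int)
  qed
qed

end

text \<open>Both directions come from maximising \<open>A z - c z\<^sup>2 / 2\<close> over \<open>z\<close>; the starting point \<open>y\<close> need not be the
  reference point \<open>y0\<close> at which the slope is controlled by \<open>A\<close>.\<close>

lemma descent_right:
  fixes f g :: "real \<Rightarrow> real"
  assumes deriv: "\<And>z. (f has_real_derivative g z) (at z)" and "0 < c" "y0 \<le> y" "y \<le> y'"
    and slope: "\<And>z. y0 \<le> z \<Longrightarrow> z \<le> y' \<Longrightarrow> c * (z - y0) - A \<le> g z"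
  shows "f y - f y' \<le> A\<^sup>2 / (2 * c)"
proof -
  \<comment> \<open>\<open>\<psi>\<close> is \<open>f\<close> minus an antiderivative of the lower
    bound for its slope, hence nondecreasing from \<open>y\<close> to \<open>y'\<close>.\<close>
  define \<psi> where "\<psi> z = f z + A * z - c * (z - y0)\<^sup>2 / 2" for z
  have "\<psi> y \<le> \<psi> y'"
  proof (rule DERIV_nonneg_imp_nondecreasing[OF \<open>y \<le> y'\<close>])
    fix z assume z: "y \<le> z" "z \<le> y'"
    have "(\<psi> has_real_derivative g z + A - c * (z - y0)) (at z)"
      unfolding \<psi>_def by (rule derivative_eq_intros deriv refl | simp)+
    then show "\<exists>d. (\<psi> has_real_derivative d) (at z) \<and> 0 \<le> d"
      using slope[of z] z \<open>y0 \<le> y\<close> by force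
  qed
  \<comment> \<open>As \<open>y\<close> lies right of \<open>y0\<close>, the difference of the
    squares is at least the square of the increment, and \<open>y0\<close> drops out of the
    estimate.\<close>
  moreover have "(y' - y)\<^sup>2 \<le> (y' - y0)\<^sup>2 - (y - y0)\<^sup>2"
    using mult_nonneg_nonneg[of "y' - y" "y - y0"] assms by (simp add: power2_eq_square algebra_simps)
  then have "c * (y' - y)\<^sup>2 \<le> c * ((y' - y0)\<^sup>2 - (y - y0)\<^sup>2)"
    using \<open>0 < c\<close> by simp
  ultimately have "f y - f y' \<le> A * (y' - y) - c * (y' - y)\<^sup>2 / 2"
    unfolding \<psi>_def by (simp add: algebra_simps)
  also have "\<dots> \<le> A\<^sup>2 / (2 * c)"
    using zero_le_power2[of "A - c * (y' - y)"] \<open>0 < c\<close> by (simp add: field_simps power2_eq_square)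
  finally show ?thesis .
qed

lemma descent_left:
  fixes f g :: "real \<Rightarrow> real"
  assumes deriv: "\<And>z. (f has_real_derivative g z) (at z)" and "0 < c" "y' \<le> y"
    and slope: "\<And>z. y' \<le> z \<Longrightarrow> z \<le> y \<Longrightarrow> g z \<le> A - c * (y - z)"
  shows "f y - f y' \<le> A\<^sup>2 / (2 * c)"
proof -
  \<comment> \<open>Reflection at 0 turns the move to the left into a move to the right, with
    \<open>- y\<close> both as starting point and as reference point.\<close>
  have "f (- (- y)) - f (- (- y')) \<le> A\<^sup>2 / (2 * c)"
  proof (rule descent_right[where f="\<lambda>z. f (- z)" and g="\<lambda>z. - g (- z)" and ?y0.0="- y" and y="- y" and y'="- y'"])
    show "((\<lambda>z. f (- z)) has_real_derivative - g (- z)) (at z)" for z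
      using DERIV_chain2[where f=f and g=uminus, OF deriv[of "- z"] DERIV_minus[OF DERIV_ident]] by simp
    show "c * (z - - y) - A \<le> - g (- z)" if "- y \<le> z" "z \<le> - y'" for z
      using slope[of "- z"] that by (simp add: algebra_simps)
  qed (use assms in auto)
  then show ?thesis by simp
qed

lemma (in real_distribution) interval_prob_le:
  assumes lip: "L-lipschitz_on UNIV (cdf M)" and "0 < \<epsilon>"
  shows "prob {c - \<epsilon>..c + \<epsilon>} \<le> 3 * L * \<epsilon>"
proof -
  \<comment> \<open>Differences of the CDF measure left-open intervals. The closed interval of
    length \<open>2 * \<epsilon>\<close> is therefore enlarged on the left to length
    \<open>3 * \<epsilon>\<close>, which is where the factor 3 comes from.\<close>
  have "prob {c - \<epsilon>..c + \<epsilon>} \<le> prob {c - 2 * \<epsilon><..c + \<epsilon>}"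
    using \<open>0 < \<epsilon>\<close> by (intro finite_measure_mono) auto
  also have "\<dots> = cdf M (c + \<epsilon>) - cdf M (c - 2 * \<epsilon>)"
    using \<open>0 < \<epsilon>\<close> by (intro cdf_diff_eq[symmetric]) simp
  also have "\<dots> \<le> L * \<bar>(c + \<epsilon>) - (c - 2 * \<epsilon>)\<bar>"
    using lipschitz_onD[OF lip, of "c + \<epsilon>" "c - 2 * \<epsilon>"] by (simp add: dist_real_def)
  finally show ?thesis using \<open>0 < \<epsilon>\<close> by simp
qed

section \<open>Normal cones\<close>

lemma closed_normal_cone: "closed (normal_cone S x)"
proof -
  have "normal_cone S x = (\<Inter>x'\<in>S. {g. (x' - x) \<bullet> g \<le> 0})"
    by (auto simp: normal_cone_def inner_commute)
  then show ?thesis by (auto intro: closed_halfspace_le)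
qed

text \<open>A minimizer of \<open>norm (G + g)\<close> is a point of the cone nearest to
  \<open>- G\<close>; in a Euclidean space it exists because the cone is closed and contains
  0.\<close>

lemma normal_cone_arg_min:
  fixes x G :: "'a::euclidean_space"
  obtains g where "is_arg_min (\<lambda>g. (norm (G + g))\<^sup>2) (\<lambda>g. g \<in> normal_cone S x) g"
proof -
  have "0 \<in> normal_cone S x" by (simp add: normal_cone_def)
  then obtain g where g: "g \<in> normal_cone S x" "\<And>y. y \<in> normal_cone S x \<Longrightarrow> dist (- G) g \<le> dist (- G) y"
    using distance_attains_inf[OF closed_normal_cone, of S x "- G"] by blast
  have "norm (G + g) \<le> norm (G + y)" if "y \<in> normal_cone S x" for y
    using g(2)[OF that] by (simp add: dist_norm norm_minus_commute[of "- G"] add.commute)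
  then show ?thesis
    using g(1) by (intro that[of g]) (auto simp: is_arg_min_def not_less intro!: power_mono)
qed

text \<open>The set is a box, so a single coordinate may be moved while the others stay. Moving it
  to \<open>B\<close> or to 0 in the inequality that defines the normal cone gives the two
  signs.\<close>

lemma normal_cone_base_stock_sign:
  fixes x n :: "real^'i^'t::finite"
  assumes n: "n \<in> normal_cone (base_stock_set B) x" and x: "x \<in> base_stock_set B"
  shows "x $ \<tau> $ i < B \<Longrightarrow> n $ \<tau> $ i \<le> 0" and "0 < x $ \<tau> $ i \<Longrightarrow> 0 \<le> n $ \<tau> $ i"
proof -
  have *: "n $ \<tau> $ i * (c - x $ \<tau> $ i) \<le> 0" if "c \<in> {0..B}" for c
  proof -
    define x' where "x' = x + axis \<tau> (axis i (c - x $ \<tau> $ i))"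
    have "x' \<in> base_stock_set B"
      using x that by (auto simp: x'_def base_stock_set_def axis_def)
    then have "n \<bullet> (x' - x) \<le> 0" using n by (auto simp: normal_cone_def)
    then show ?thesis by (simp add: x'_def inner_axis)
  qed
  have "0 \<le> x $ \<tau> $ i" "x $ \<tau> $ i \<le> B" using x by (auto simp: base_stock_set_def)
  then show "x $ \<tau> $ i < B \<Longrightarrow> n $ \<tau> $ i \<le> 0" "0 < x $ \<tau> $ i \<Longrightarrow> 0 \<le> n $ \<tau> $ i"
    using *[of B] *[of 0] by (auto simp: mult_le_0_iff zero_le_mult_iff)
qed

section \<open>The Markov structure of inventories\<close>

text \<open>The labelling of periods by \<open>tm\<close> and the optimal levels stay outside the
  locale, so that levels can be plain functions of period and state. The case \<open>T = 0\<close>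
  is excluded only where it matters.\<close>

locale inventory_model = prob_space M for M :: "'w measure" +
  fixes T :: nat and B \<alpha> L\<^sub>\<rho> L\<^sub>D \<mu>\<^sub>D :: real
    and h b :: "nat \<Rightarrow> real"
    and \<nu> :: "'i::finite pmf" and p :: "'i \<Rightarrow> 'i pmf"
    and \<rho> :: "real \<Rightarrow> real" and dem :: "'i \<Rightarrow> real measure"
    and X1 :: "'w \<Rightarrow> real" and S :: "nat \<Rightarrow> 'w \<Rightarrow> 'i" and D :: "nat \<Rightarrow> 'w \<Rightarrow> real"
  assumes B_nonneg: "0 \<le> B"
    and cost_nonneg: "\<And>t. t \<in> {1..T} \<Longrightarrow> 0 \<le> h t \<and> 0 \<le> b t"
    and cost_pos: "\<And>t. t \<in> {1..T} \<Longrightarrow> 0 < h t + b t"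
    and stationary: "bind_pmf \<nu> p = \<nu>"
    and \<nu>_pos: "\<And>i. 0 < pmf \<nu> i"
    and demand_law: "\<And>i. real_distribution (dem i)"
    and demand_nonneg: "\<And>i. AE d in dem i. 0 \<le> d"
    and cost_finite: "\<And>t i y. t \<in> {1..T} \<Longrightarrow>
          integrable (dem i) (\<lambda>d. h t * max (y - d) 0 + b t * max (- (y - d)) 0)"
    and X1_measurable[measurable]: "X1 \<in> borel_measurable M"
    and S_measurable: "\<And>t. t \<in> {1..T} \<Longrightarrow> S t \<in> measurable M (count_space UNIV)"
    and D_measurable: "\<And>t. t \<in> {1..T} \<Longrightarrow> D t \<in> borel_measurable M"
    and X1_cdf: "cdf (distr M borel X1) = \<rho>"
    and X1_le: "AE \<omega> in M. X1 \<omega> \<le> B"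
    and chain: "\<And>s. measure M {\<omega> \<in> space M. \<forall>t\<in>{1..T}. S t \<omega> = s t} =
          pmf \<nu> (s 1) * (\<Prod>t\<in>{1..<T}. pmf (p (s t)) (s (Suc t)))"
    and demands_given_chain: "\<And>s A. (\<And>t. t \<in> {1..T} \<Longrightarrow> A t \<in> sets borel) \<Longrightarrow>
          measure M {\<omega> \<in> space M. \<forall>t\<in>{1..T}. S t \<omega> = s t \<and> D t \<omega> \<in> A t} =
          measure M {\<omega> \<in> space M. \<forall>t\<in>{1..T}. S t \<omega> = s t} *
          (\<Prod>t\<in>{1..T}. measure (dem (s t)) (A t))"
    and X1_indep: "indep_set
          (sets (vimage_algebra (space M) X1 borel))
          (sets (vimage_algebra (space M) (\<lambda>\<omega>. \<lambda>t\<in>{1..T}. (S t \<omega>, D t \<omega>))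
             (PiM {1..T} (\<lambda>_. count_space UNIV \<Otimes>\<^sub>M borel))))"
    and \<rho>_lipschitz: "L\<^sub>\<rho>-lipschitz_on UNIV \<rho>"
    and dem_lipschitz: "\<And>i. L\<^sub>D-lipschitz_on UNIV (cdf (dem i))"
    and \<alpha>_pos: "0 < \<alpha>" and \<rho>_ge: "\<alpha> \<le> \<rho> 0" and dem_le: "\<And>i. cdf (dem i) B \<le> 1 - \<alpha>"
    and \<mu>\<^sub>D_pos: "0 < \<mu>\<^sub>D"
    and dem_density: "\<And>i. \<exists>q. q \<in> borel_measurable lborel \<and> (\<forall>d. 0 \<le> q d) \<and>
          dem i = density lborel (\<lambda>d. ennreal (q d)) \<and> (\<forall>d\<in>{0..B}. \<mu>\<^sub>D \<le> q d)"
begin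

abbreviation stock :: "(nat \<Rightarrow> 'i \<Rightarrow> real) \<Rightarrow> nat \<Rightarrow> 'w \<Rightarrow> real" where
  "stock \<theta> t \<omega> \<equiv> inventory \<theta> (X1 \<omega>) (\<lambda>t. S t \<omega>) (\<lambda>t. D t \<omega>) t"

lemma stock_Suc: "1 \<le> t \<Longrightarrow> stock \<theta> (Suc t) \<omega> = max (stock \<theta> t \<omega>) (\<theta> t (S t \<omega>)) - D t \<omega>"
  by simp

lemma sets_dem [measurable_cong, simp]: "sets (dem i) = sets borel"
  using real_distribution.events_eq_borel[OF demand_law] .

lemma space_dem [simp]: "space (dem i) = UNIV"
  using real_distribution.space_eq_univ[OF demand_law] .

lemma measure_dem_UNIV [simp]: "measure (dem i) UNIV = 1"
  using prob_space.prob_space[OF real_distribution.axioms(1)[OF demand_law], of i] by simp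

lemma stock_measurable: "t \<le> Suc T \<Longrightarrow> stock \<theta> t \<in> borel_measurable M"
proof (induction t)
  case (Suc t)
  show ?case
  proof (cases "t = 0")
    case False
    then have [measurable]: "S t \<in> measurable M (count_space UNIV)" "D t \<in> borel_measurable M"
        "stock \<theta> t \<in> borel_measurable M"
      using Suc S_measurable D_measurable by auto
    show ?thesis using False by simp
  qed simp
qed simp

lemma path_set_measurable:
  assumes "n \<le> T" "1 \<le> m" "\<And>r. r \<in> {m..n} \<Longrightarrow> C r \<in> sets borel"
  shows "{\<omega> \<in> space M. \<forall>r\<in>{m..n}. S r \<omega> = s r \<and> D r \<omega> \<in> C r} \<in> events"
proof (rule sets.sets_Collect_finite_All)
  fix r assume r: "r \<in> {m..n}"
  then have [measurable]: "S r \<in> measurable M (count_space UNIV)" "D r \<in> borel_measurable M" "C r \<in> sets borel"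
    using assms S_measurable D_measurable by auto
  show "{\<omega> \<in> space M. S r \<omega> = s r \<and> D r \<omega> \<in> C r} \<in> events" by measurable
qed (use assms in auto)

text \<open>The hypotheses give the joint law of the whole horizon only. Shorter horizons follow by
  descending induction: the demand of period \<open>Suc n\<close> is left free, and the sum over its
  state is a sum of transition probabilities, which is 1.\<close>

lemma path_prob:
  assumes "1 \<le> n" "n \<le> T" "\<And>r. r \<in> {1..n} \<Longrightarrow> C r \<in> sets borel"
  shows "prob {\<omega> \<in> space M. \<forall>r\<in>{1..n}. S r \<omega> = s r \<and> D r \<omega> \<in> C r}
    = pmf \<nu> (s 1) * (\<Prod>r\<in>{1..<n}. pmf (p (s r)) (s (Suc r))) * (\<Prod>r\<in>{1..n}. measure (dem (s r)) (C r))"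
  using \<open>n \<le> T\<close> assms(1,3)
proof (induction n arbitrary: s C rule: inc_induct)
  case base
  then show ?case using demands_given_chain[of C s] chain[of s] by simp
next
  case (step n)
  have meas: "{\<omega> \<in> space M. \<forall>r\<in>{1..n}. S r \<omega> = s r \<and> D r \<omega> \<in> C r} \<in> events"
    using step by (intro path_set_measurable) auto
  have ev: "(\<forall>r\<in>{1..n}. S r \<omega> = s r \<and> D r \<omega> \<in> C r) \<and> S (Suc n) \<omega> = j \<longleftrightarrow>
      (\<forall>r\<in>{1..Suc n}. S r \<omega> = (s(Suc n := j)) r \<and> D r \<omega> \<in> (C(Suc n := UNIV)) r)" for j \<omega>
    by (auto simp: atLeastAtMostSuc_conv)
  have "prob {\<omega> \<in> space M. \<forall>r\<in>{1..n}. S r \<omega> = s r \<and> D r \<omega> \<in> C r}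
      = (\<Sum>j\<in>UNIV. prob {\<omega> \<in> space M. (\<forall>r\<in>{1..n}. S r \<omega> = s r \<and> D r \<omega> \<in> C r) \<and> S (Suc n) \<omega> = j})"
    by (rule prob_eq_sum_fibres[OF S_measurable meas]) (use step.hyps in auto)
  also have "\<dots> = (\<Sum>j\<in>UNIV. pmf \<nu> (s 1) * (\<Prod>r\<in>{1..<n}. pmf (p (s r)) (s (Suc r)))
      * (\<Prod>r\<in>{1..n}. measure (dem (s r)) (C r)) * pmf (p (s n)) j)"
  proof (rule sum.cong[OF refl])
    fix j
    show "prob {\<omega> \<in> space M. (\<forall>r\<in>{1..n}. S r \<omega> = s r \<and> D r \<omega> \<in> C r) \<and> S (Suc n) \<omega> = j}
      = pmf \<nu> (s 1) * (\<Prod>r\<in>{1..<n}. pmf (p (s r)) (s (Suc r)))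
      * (\<Prod>r\<in>{1..n}. measure (dem (s r)) (C r)) * pmf (p (s n)) j"
      unfolding ev using step.prems
      by (subst step.IH) (auto simp: le_Suc_eq prod.atLeastLessThan_Suc)
  qed
  also have "\<dots> = pmf \<nu> (s 1) * (\<Prod>r\<in>{1..<n}. pmf (p (s r)) (s (Suc r))) * (\<Prod>r\<in>{1..n}. measure (dem (s r)) (C r))"
    by (simp add: sum_distrib_left[symmetric] sum_pmf_eq_1)
  finally show ?case .
qed

lemma X1_path_prob:
  assumes "1 \<le> n" "n \<le> T" "\<And>r. r \<in> {1..n} \<Longrightarrow> C r \<in> sets borel" and A: "A \<in> sets borel"
  shows "prob {\<omega> \<in> space M. X1 \<omega> \<in> A \<and> (\<forall>r\<in>{1..n}. S r \<omega> = s r \<and> D r \<omega> \<in> C r)}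
    = prob {\<omega> \<in> space M. X1 \<omega> \<in> A} * prob {\<omega> \<in> space M. \<forall>r\<in>{1..n}. S r \<omega> = s r \<and> D r \<omega> \<in> C r}"
proof -
  let ?Z = "\<lambda>\<omega>. \<lambda>t\<in>{1..T}. (S t \<omega>, D t \<omega>)" and ?N = "PiM {1..T} (\<lambda>_. count_space UNIV \<Otimes>\<^sub>M borel)"
  \<comment> \<open>The event on the first \<open>n\<close> periods becomes a box over all periods
    with full factors after \<open>n\<close>, because the independence hypothesis speaks of
    preimages under the whole path \<open>?Z\<close>.\<close>
  let ?R = "PiE {1..T} (\<lambda>r. if r \<le> n then {s r} \<times> C r else UNIV)"
  have "?R \<in> sets ?N"
  proof (rule sets_PiM_I_finite)
    fix r assume "r \<in> {1..T}"
    then show "(if r \<le> n then {s r} \<times> C r else UNIV) \<in> sets (count_space UNIV \<Otimes>\<^sub>M borel)"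
      using assms sets.top[of "count_space UNIV \<Otimes>\<^sub>M borel"] by (auto simp: space_pair_measure)
  qed simp
  then have "?Z -` ?R \<inter> space M \<in> sets (vimage_algebra (space M) ?Z ?N)"
    by (rule in_vimage_algebra)
  moreover have "X1 -` A \<inter> space M \<in> sets (vimage_algebra (space M) X1 borel)"
    using A by (rule in_vimage_algebra)
  ultimately have "prob ((X1 -` A \<inter> space M) \<inter> (?Z -` ?R \<inter> space M)) = prob (X1 -` A \<inter> space M) * prob (?Z -` ?R \<inter> space M)"
    using indep_setD[OF X1_indep] by blast
  moreover have Z: "?Z \<omega> \<in> ?R \<longleftrightarrow> (\<forall>r\<in>{1..n}. S r \<omega> = s r \<and> D r \<omega> \<in> C r)" for \<omega>
    using assms(2) by (fastforce simp: PiE_iff split: if_splits)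
  have "?Z -` ?R \<inter> space M = {\<omega> \<in> space M. \<forall>r\<in>{1..n}. S r \<omega> = s r \<and> D r \<omega> \<in> C r}"
    unfolding vimage_def mem_Collect_eq Z by blast
  moreover have "X1 -` A \<inter> space M = {\<omega> \<in> space M. X1 \<omega> \<in> A}" by auto
  moreover have "{\<omega> \<in> space M. X1 \<omega> \<in> A} \<inter> {\<omega> \<in> space M. \<forall>r\<in>{1..n}. S r \<omega> = s r \<and> D r \<omega> \<in> C r}
      = {\<omega> \<in> space M. X1 \<omega> \<in> A \<and> (\<forall>r\<in>{1..n}. S r \<omega> = s r \<and> D r \<omega> \<in> C r)}" by auto
  ultimately show ?thesis by simp
qed

text \<open>The Markov property at time \<open>t\<close>; the whole future is kept in the statement because the
  induction on \<open>t\<close> consumes one future period per step.\<close>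

lemma future_prob:
  assumes "1 \<le> t" "t \<le> n" "n \<le> T" "A \<in> sets borel" "\<And>r. r \<in> {t..n} \<Longrightarrow> C r \<in> sets borel"
  shows "prob {\<omega> \<in> space M. stock \<theta> t \<omega> \<in> A \<and> (\<forall>r\<in>{t..n}. S r \<omega> = s r \<and> D r \<omega> \<in> C r)}
    = prob {\<omega> \<in> space M. stock \<theta> t \<omega> \<in> A \<and> S t \<omega> = s t}
      * (\<Prod>r\<in>{t..<n}. pmf (p (s r)) (s (Suc r))) * (\<Prod>r\<in>{t..n}. measure (dem (s r)) (C r))"
  using assms
proof (induction t arbitrary: A n s C rule: nat_induct_at_least)
  case base
  have "prob {\<omega> \<in> space M. X1 \<omega> \<in> A \<and> S 1 \<omega> = s 1} =
      prob {\<omega> \<in> space M. X1 \<omega> \<in> A \<and> (\<forall>r\<in>{1..1}. S r \<omega> = s r \<and> D r \<omega> \<in> UNIV)}"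
    by (intro arg_cong[where f=prob]) auto
  also have "\<dots> = prob {\<omega> \<in> space M. X1 \<omega> \<in> A} * pmf \<nu> (s 1)"
    using base path_prob[of 1 "\<lambda>_. UNIV" s] by (subst X1_path_prob) auto
  finally show ?case
    using base X1_path_prob[of n C A s] path_prob[of n C s] by simp
next
  case (Suc t)
  then have "t \<in> {1..T}" by auto
  note [measurable] = S_measurable[OF this] D_measurable[OF this]
  have [measurable]: "stock \<theta> t \<in> borel_measurable M" "stock \<theta> (Suc t) \<in> borel_measurable M"
    using Suc by (auto intro!: stock_measurable simp del: inventory.simps)
  note inventory.simps[simp del]
  define \<phi> where "\<phi> i x d = (indicator A (max x (\<theta> t i) - d) :: real)" for i x d
  have [measurable]: "A \<in> sets borel" by fact
  \<comment> \<open>\<open>\<Gamma> j\<close> carries no trace of the future after period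
    \<open>Suc t\<close>. Taking the shortest future in \<open>main\<close> identifies it as the
    probability that the next inventory lies in \<open>A\<close> and the next state is
    \<open>j\<close>.\<close>
  define \<Gamma> where "\<Gamma> j = (\<Sum>i\<in>UNIV. pmf (p i) j * expectation (\<lambda>\<omega>. indicator {\<omega>. S t \<omega> = i} \<omega> * (\<integral>d. \<phi> i (stock \<theta> t \<omega>) d \<partial>dem i)))" for j
  have main: "prob {\<omega> \<in> space M. stock \<theta> (Suc t) \<omega> \<in> A \<and> (\<forall>r\<in>{Suc t..n}. S r \<omega> = s r \<and> D r \<omega> \<in> C r)}
      = \<Gamma> (s (Suc t)) * (\<Prod>r\<in>{Suc t..<n}. pmf (p (s r)) (s (Suc r))) * (\<Prod>r\<in>{Suc t..n}. measure (dem (s r)) (C r))"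
    if n: "Suc t \<le> n" "n \<le> T" and C: "\<And>r. r \<in> {Suc t..n} \<Longrightarrow> C r \<in> sets borel" for n s C
  proof -
    let ?E = "\<lambda>\<omega>. \<forall>r\<in>{Suc t..n}. S r \<omega> = s r \<and> D r \<omega> \<in> C r"
    define rest where "rest = (\<Prod>r\<in>{Suc t..<n}. pmf (p (s r)) (s (Suc r))) * (\<Prod>r\<in>{Suc t..n}. measure (dem (s r)) (C r))"
    have [measurable]: "{\<omega> \<in> space M. ?E \<omega>} \<in> events"
      using n C by (intro path_set_measurable) auto
    have F[measurable]: "{\<omega> \<in> space M. S t \<omega> = i \<and> ?E \<omega>} \<in> events" for i by measurable
    have "prob {\<omega> \<in> space M. stock \<theta> (Suc t) \<omega> \<in> A \<and> ?E \<omega>}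
        = (\<Sum>i\<in>UNIV. prob {\<omega> \<in> space M. (stock \<theta> (Suc t) \<omega> \<in> A \<and> ?E \<omega>) \<and> S t \<omega> = i})"
      by (rule prob_eq_sum_fibres) measurable
    also have "\<dots> = (\<Sum>i\<in>UNIV. pmf (p i) (s (Suc t)) * rest
        * expectation (\<lambda>\<omega>. indicator {\<omega>. S t \<omega> = i} \<omega> * (\<integral>d. \<phi> i (stock \<theta> t \<omega>) d \<partial>dem i)))"
    proof (rule sum.cong[OF refl])
      fix i
      have "prob {\<omega> \<in> space M. (stock \<theta> (Suc t) \<omega> \<in> A \<and> ?E \<omega>) \<and> S t \<omega> = i}
          = expectation (indicator {\<omega> \<in> space M. (stock \<theta> (Suc t) \<omega> \<in> A \<and> ?E \<omega>) \<and> S t \<omega> = i})"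
        by (simp add: Int_absorb1)
      also have "\<dots> = expectation (\<lambda>\<omega>. indicator {\<omega>. S t \<omega> = i \<and> ?E \<omega>} \<omega> * \<phi> i (stock \<theta> t \<omega>) (D t \<omega>))"
        using Suc.hyps by (intro Bochner_Integration.integral_cong refl) (auto simp: \<phi>_def indicator_def stock_Suc inventory.simps)
      also have "\<dots> = pmf (p i) (s (Suc t)) * rest
          * expectation (\<lambda>\<omega>. indicator {\<omega>. S t \<omega> = i} \<omega> * (\<integral>d. \<phi> i (stock \<theta> t \<omega>) d \<partial>dem i))"
      \<comment> \<open>Here \<kappa> is the transition probability into \<open>s (Suc t)\<close>
        times the probability \<open>rest\<close> of the later states and demands.\<close>
      proof (rule expectation_conditionally_indep[where K=1, OF demand_law])
        fix A' C' :: "real set" assume A': "A' \<in> sets borel" "C' \<in> sets borel"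
        have split: "{t..n} = insert t {Suc t..n}" using n by auto
        have "prob {\<omega> \<in> space M. stock \<theta> t \<omega> \<in> A' \<and> D t \<omega> \<in> C' \<and> S t \<omega> = i \<and> ?E \<omega>}
            = prob {\<omega> \<in> space M. stock \<theta> t \<omega> \<in> A' \<and>
                (\<forall>r\<in>{t..n}. S r \<omega> = (s(t := i)) r \<and> D r \<omega> \<in> (C(t := C')) r)}"
          unfolding split by (intro arg_cong[where f=prob]) auto
        also have "\<dots> = prob {\<omega> \<in> space M. stock \<theta> t \<omega> \<in> A' \<and> S t \<omega> = i} * (pmf (p i) (s (Suc t)) * rest) * measure (dem i) C'"
          using n C A' by (subst Suc.IH) (auto simp: rest_def prod.atLeast_Suc_lessThan prod.atLeast_Suc_atMost)
        finally show "prob {\<omega> \<in> space M. stock \<theta> t \<omega> \<in> A' \<and> D t \<omega> \<in> C' \<and> S t \<omega> = i \<and> ?E \<omega>}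
          = prob {\<omega> \<in> space M. stock \<theta> t \<omega> \<in> A' \<and> S t \<omega> = i} * (pmf (p i) (s (Suc t)) * rest) * measure (dem i) C'" .
      qed (auto simp: \<phi>_def rest_def indicator_def intro!: prod_nonneg mult_nonneg_nonneg)
      finally show "prob {\<omega> \<in> space M. (stock \<theta> (Suc t) \<omega> \<in> A \<and> ?E \<omega>) \<and> S t \<omega> = i} = \<dots>" .
    qed
    finally show ?thesis
      by (simp add: \<Gamma>_def rest_def sum_distrib_left sum_distrib_right mult_ac)
  qed
  have "{\<omega> \<in> space M. stock \<theta> (Suc t) \<omega> \<in> A \<and> S (Suc t) \<omega> = s (Suc t)}
      = {\<omega> \<in> space M. stock \<theta> (Suc t) \<omega> \<in> A \<and> (\<forall>r\<in>{Suc t..Suc t}. S r \<omega> = s r \<and> D r \<omega> \<in> UNIV)}"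
    by auto
  then have "prob {\<omega> \<in> space M. stock \<theta> (Suc t) \<omega> \<in> A \<and> S (Suc t) \<omega> = s (Suc t)} = \<Gamma> (s (Suc t))"
    using main[of "Suc t" "\<lambda>_. UNIV" s] Suc.prems by simp
  then show ?case using main[of n C s] Suc.prems by simp
qed

section \<open>Marginal laws and almost sure bounds\<close>

lemma stationary_sum: "(\<Sum>i\<in>UNIV. pmf \<nu> i * pmf (p i) j) = pmf \<nu> j"
proof -
  have "pmf (bind_pmf \<nu> p) j = (\<Sum>i\<in>UNIV. pmf \<nu> i * pmf (p i) j)"
    by (simp add: pmf_bind integral_measure_pmf_real[where A=UNIV] mult.commute)
  then show ?thesis by (simp add: stationary)
qed

lemma state_prob:
  assumes "1 \<le> t" "t \<le> T"
  shows "prob {\<omega> \<in> space M. S t \<omega> = i} = pmf \<nu> i"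
  using assms
proof (induction t arbitrary: i rule: nat_induct_at_least)
  case base
  then show ?case using path_prob[of 1 "\<lambda>_. UNIV" "\<lambda>_. i"] by simp
next
  case (Suc t)
  note [measurable] = S_measurable[of t] S_measurable[of "Suc t"]
  \<comment> \<open>The pair of states is written as a two-period future of \<open>t\<close>. The
    inventory ranges over all reals, so the zero levels are a dummy.\<close>
  have ev: "{\<omega> \<in> space M. S (Suc t) \<omega> = i \<and> S t \<omega> = k} = {\<omega> \<in> space M. stock (\<lambda>_ _. 0) t \<omega> \<in> UNIV \<and>
     (\<forall>r\<in>{t..Suc t}. S r \<omega> = (if r = t then k else i) \<and> D r \<omega> \<in> UNIV)}" for k
    by (auto simp: atLeastAtMostSuc_conv)
  have "prob {\<omega> \<in> space M. S (Suc t) \<omega> = i} = (\<Sum>k\<in>UNIV. prob {\<omega> \<in> space M. S (Suc t) \<omega> = i \<and> S t \<omega> = k})"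
    using Suc by (intro prob_eq_sum_fibres) auto
  also have "\<dots> = (\<Sum>k\<in>UNIV. pmf \<nu> k * pmf (p k) i)"
    unfolding ev using Suc by (subst future_prob) auto
  finally show ?case by (simp only: stationary_sum)
qed

text \<open>A two-period future with free second demand, in the form in which
  \<open>expectation_conditionally_indep\<close> takes it, with \<open>pmf (p i) j\<close> as
  \<kappa>.\<close>

lemma transition_prob:
  assumes "1 \<le> t" "t < T" "A \<in> sets borel" "C \<in> sets borel"
  shows "prob {\<omega> \<in> space M. stock \<theta> t \<omega> \<in> A \<and> D t \<omega> \<in> C \<and> S t \<omega> = i \<and> S (Suc t) \<omega> = j}
    = prob {\<omega> \<in> space M. stock \<theta> t \<omega> \<in> A \<and> S t \<omega> = i} * pmf (p i) j * measure (dem i) C"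
proof -
  have "{\<omega> \<in> space M. stock \<theta> t \<omega> \<in> A \<and> D t \<omega> \<in> C \<and> S t \<omega> = i \<and> S (Suc t) \<omega> = j} =
    {\<omega> \<in> space M. stock \<theta> t \<omega> \<in> A \<and> (\<forall>r\<in>{t..Suc t}. S r \<omega> = (if r = t then i else j) \<and> D r \<omega> \<in> (if r = t then C else UNIV))}"
    by (auto simp: atLeastAtMostSuc_conv)
  then show ?thesis using assms by (simp add: future_prob)
qed

text \<open>Nonnegativity is assumed for the conditional laws. It passes to \<open>D t\<close>
  because there are finitely many states and each contributes a null event.\<close>

lemma AE_demand_nonneg:
  assumes "1 \<le> t" "t \<le> T"
  shows "AE \<omega> in M. 0 \<le> D t \<omega>"
proof -
  have t: "t \<in> {1..T}" using assms by auto
  note [measurable] = S_measurable[OF t] D_measurable[OF t]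
  have "AE \<omega> in M. \<not> (S t \<omega> = i \<and> D t \<omega> < 0)" for i
  proof -
    have zero: "measure (dem i) {..<0} = 0"
      using demand_nonneg[of i] AE_iff_measurable[of "{..<0}" "dem i" "\<lambda>d. 0 \<le> d"]
      by (auto simp: measure_def not_le lessThan_def)
    have ev: "{\<omega> \<in> space M. S t \<omega> = i \<and> D t \<omega> < 0} = {\<omega> \<in> space M. stock (\<lambda>_ _. 0) t \<omega> \<in> UNIV \<and> (\<forall>r\<in>{t..t}. S r \<omega> = i \<and> D r \<omega> \<in> {..<0})}"
      by auto
    have "prob {\<omega> \<in> space M. S t \<omega> = i \<and> D t \<omega> < 0} = 0"
      unfolding ev using assms by (subst future_prob) (auto simp: zero)
    then show ?thesis
      by (subst AE_iff_measurable[OF _ refl]) (auto simp: emeasure_eq_measure)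
  qed
  then have "AE \<omega> in M. \<forall>i. \<not> (S t \<omega> = i \<and> D t \<omega> < 0)" by (intro AE_all_countable[THEN iffD2] allI)
  then show ?thesis by eventually_elim auto
qed

text \<open>Demand only lowers the inventory, and orders raise it at most to a base-stock level. The
  bound \<open>C\<close> may exceed \<open>B\<close> because the gradient is taken in the whole
  space, so that levels outside the parameter set occur.\<close>

lemma AE_stock_le:
  assumes "1 \<le> t" "t \<le> Suc T" "B \<le> C" "\<And>r i. r \<in> {1..T} \<Longrightarrow> \<theta> r i \<le> C"
  shows "AE \<omega> in M. stock \<theta> t \<omega> \<le> C"
  using assms(1,2)
proof (induction t rule: nat_induct_at_least)
  case base
  have "AE \<omega> in M. X1 \<omega> \<le> C" using X1_le by eventually_elim (use \<open>B \<le> C\<close> in simp)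
  then show ?case by simp
next
  case (Suc t)
  then have "AE \<omega> in M. stock \<theta> t \<omega> \<le> C" "AE \<omega> in M. 0 \<le> D t \<omega>" using AE_demand_nonneg by auto
  then show ?case
  proof eventually_elim
    case (elim \<omega>)
    then show ?case using Suc assms(4)[of t "S t \<omega>"] by auto
  qed
qed

lemma state_measurable:
  assumes "t \<in> {1..T}" and [measurable]: "\<And>i. \<Psi> i \<in> borel_measurable borel"
  shows "(\<lambda>\<omega>. \<Psi> (S t \<omega>) (stock \<theta> t \<omega>)) \<in> borel_measurable M"
proof -
  have [measurable]: "stock \<theta> t \<in> borel_measurable M" "S t \<in> measurable M (count_space UNIV)"
    using assms by (auto intro: stock_measurable S_measurable)
  show ?thesis by (rule measurable_compose_countable[where g="S t"]) measurable
qed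

lemma levels_bounded:
  fixes \<theta> :: "nat \<Rightarrow> 'i \<Rightarrow> real"
  obtains C where "B \<le> C" "\<And>r i. r \<in> {1..T} \<Longrightarrow> \<theta> r i \<le> (C::real)"
proof
  let ?A = "insert B ((\<lambda>(r, i). \<theta> r i) ` ({1..T} \<times> (UNIV :: 'i set)))"
  show "B \<le> Max ?A" by simp
  show "\<theta> r i \<le> Max ?A" if "r \<in> {1..T}" for r i
    using that by (intro Max_ge) force+
qed

lemma indicator_state_measurable:
  assumes "t \<in> {1..T}"
  shows "(indicator {\<omega>. S t \<omega> = i} :: 'w \<Rightarrow> real) \<in> borel_measurable M"
proof -
  have "(\<lambda>\<omega>. indicator {i} (S t \<omega>) :: real) \<in> borel_measurable M"
    by (rule measurable_compose[OF S_measurable[OF assms]]) simp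
  also have "(\<lambda>\<omega>. indicator {i} (S t \<omega>)) = (indicator {\<omega>. S t \<omega> = i} :: 'w \<Rightarrow> real)"
    by (rule ext) (simp add: indicator_def)
  finally show ?thesis .
qed

text \<open>Cost-to-go functions are unbounded above only to the right, where inventories do not go.\<close>

definition left_bounded :: "(real \<Rightarrow> 'i \<Rightarrow> real) \<Rightarrow> bool" where
  "left_bounded \<phi> \<longleftrightarrow> (\<forall>i. (\<lambda>x. \<phi> x i) \<in> borel_measurable borel) \<and> (\<forall>C. \<exists>K. \<forall>x\<le>C. \<forall>i. \<bar>\<phi> x i\<bar> \<le> K)"

text \<open>Since demand is nonnegative, \<open>y - d\<close> stays left of \<open>y\<close>, where
  \<open>\<phi>\<close> is bounded.\<close>

lemma left_bounded_integrable_dem: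
  assumes "left_bounded \<phi>"
  shows "integrable (dem i) (\<lambda>d. \<phi> (y - d) j)"
proof -
  interpret N: real_distribution "dem i" by (rule demand_law)
  have [measurable]: "(\<lambda>x. \<phi> x j) \<in> borel_measurable borel" using assms by (auto simp: left_bounded_def)
  obtain K where K: "\<And>x. x \<le> y \<Longrightarrow> \<bar>\<phi> x j\<bar> \<le> K" using assms unfolding left_bounded_def by metis
  have "AE d in dem i. norm (\<phi> (y - d) j) \<le> K"
    using demand_nonneg[of i] by eventually_elim (auto intro: K)
  then show ?thesis by (intro N.integrable_const_bound) measurable
qed

lemma left_bounded_integrable:
  assumes "left_bounded \<phi>" "t \<in> {1..T}"
  shows "integrable M (\<lambda>\<omega>. \<phi> (stock \<theta> t \<omega>) (S t \<omega>))"
proof -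
  obtain C where C: "B \<le> C" "\<And>r i. r \<in> {1..T} \<Longrightarrow> \<theta> r i \<le> C" using levels_bounded[of \<theta>] by blast
  obtain K where K: "\<And>x i. x \<le> C \<Longrightarrow> \<bar>\<phi> x i\<bar> \<le> K" using assms unfolding left_bounded_def by metis
  have "AE \<omega> in M. stock \<theta> t \<omega> \<le> C" using assms C by (intro AE_stock_le) auto
  then have "AE \<omega> in M. norm (\<phi> (stock \<theta> t \<omega>) (S t \<omega>)) \<le> K"
    by eventually_elim (auto intro: K)
  moreover have "(\<lambda>\<omega>. \<phi> (stock \<theta> t \<omega>) (S t \<omega>)) \<in> borel_measurable M"
    using state_measurable[of t "\<lambda>i x. \<phi> x i"] assms by (auto simp: left_bounded_def)
  ultimately show ?thesis by (intro integrable_const_bound) auto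
qed

section \<open>One step of the inventory process in expectation\<close>

lemma next_expectation_measurable:
  assumes [measurable]: "\<And>j. (\<lambda>x. \<phi> x j) \<in> borel_measurable borel"
  shows "(\<lambda>x. \<Sum>j\<in>UNIV. pmf (p i) j * (\<integral>d. \<phi> (max x c - d) j \<partial>dem i)) \<in> borel_measurable borel"
proof -
  interpret N: real_distribution "dem i" by (rule demand_law)
  show ?thesis by measurable
qed

text \<open>Splitting over current and next state leaves, for each pair, a function of
  \<open>stock \<theta> t\<close> and \<open>D t\<close> on an event where
  \<open>transition_prob\<close> supplies the factorization that
  \<open>expectation_conditionally_indep\<close> asks for.\<close>

lemma expectation_step_bounded:
  assumes t: "1 \<le> t" "t < T" and [measurable]: "\<And>j. (\<lambda>x. \<phi> x j) \<in> borel_measurable borel"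
    and bnd: "\<And>x j. \<bar>\<phi> x j\<bar> \<le> K"
  shows "expectation (\<lambda>\<omega>. \<phi> (stock \<theta> (Suc t) \<omega>) (S (Suc t) \<omega>))
    = expectation (\<lambda>\<omega>. \<Sum>j\<in>UNIV. pmf (p (S t \<omega>)) j *
        (\<integral>d. \<phi> (max (stock \<theta> t \<omega>) (\<theta> t (S t \<omega>)) - d) j \<partial>dem (S t \<omega>)))"
proof -
  have mem: "t \<in> {1..T}" "Suc t \<in> {1..T}" using t by auto
  note [measurable] = S_measurable[OF mem(1)] D_measurable[OF mem(1)] S_measurable[OF mem(2)]
  have [measurable]: "stock \<theta> t \<in> borel_measurable M" "stock \<theta> (Suc t) \<in> borel_measurable M"
    using t by (auto intro!: stock_measurable simp del: inventory.simps)
  note inventory.simps[simp del]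
  interpret N: real_distribution "dem k" for k by (rule demand_law)
  have [simp]: "0 \<le> K" using bnd[of 0 undefined] by linarith
  have lb: "left_bounded \<phi>" using bnd by (auto simp: left_bounded_def)
  have int1: "integrable M (\<lambda>\<omega>. \<phi> (stock \<theta> (Suc t) \<omega>) (S (Suc t) \<omega>))"
    by (rule left_bounded_integrable[OF lb mem(2)])
  have bnd': "\<bar>\<integral>d. \<phi> (y - d) j \<partial>dem i\<bar> \<le> K" for y i j
  proof -
    have "\<bar>\<integral>d. \<phi> (y - d) j \<partial>dem i\<bar> \<le> (\<integral>d. \<bar>\<phi> (y - d) j\<bar> \<partial>dem i)" by (rule integral_abs_bound)
    also have "\<dots> \<le> (\<integral>d. K \<partial>dem i)"
      using bnd by (intro integral_mono integrable_abs left_bounded_integrable_dem[OF lb]) auto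
    finally show ?thesis using measure_dem_UNIV[of i] by simp
  qed
  have "\<bar>\<Sum>j\<in>UNIV. pmf (p i) j * (\<integral>d. \<phi> (y - d) j \<partial>dem i)\<bar> \<le> K" for y i
  proof -
    have "\<bar>\<Sum>j\<in>UNIV. pmf (p i) j * (\<integral>d. \<phi> (y - d) j \<partial>dem i)\<bar> \<le> (\<Sum>j\<in>UNIV. pmf (p i) j * K)"
      using bnd' by (intro order_trans[OF sum_abs] sum_mono) (auto simp: abs_mult intro: mult_left_mono)
    then show ?thesis by (simp add: sum_distrib_right[symmetric] sum_pmf_eq_1)
  qed
  then have lb2: "left_bounded (\<lambda>x i. \<Sum>j\<in>UNIV. pmf (p i) j * (\<integral>d. \<phi> (max x (\<theta> t i) - d) j \<partial>dem i))"
    using next_expectation_measurable[of \<phi>] by (auto simp: left_bounded_def)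
  have int2: "integrable M (\<lambda>\<omega>. \<Sum>j\<in>UNIV. pmf (p (S t \<omega>)) j *
        (\<integral>d. \<phi> (max (stock \<theta> t \<omega>) (\<theta> t (S t \<omega>)) - d) j \<partial>dem (S t \<omega>)))"
    using left_bounded_integrable[OF lb2 mem(1)] by simp
  have "expectation (\<lambda>\<omega>. \<phi> (stock \<theta> (Suc t) \<omega>) (S (Suc t) \<omega>)) =
     (\<Sum>i\<in>UNIV. \<Sum>j\<in>UNIV. expectation (\<lambda>\<omega>. indicator {\<omega>. S t \<omega> = i \<and> S (Suc t) \<omega> = j} \<omega> * \<phi> (max (stock \<theta> t \<omega>) (\<theta> t i) - D t \<omega>) j))"
  proof (subst expectation_eq_sum_fibres[where Y="S t"], measurable, fact int1, rule sum.cong[OF refl])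
    fix i
    have "integrable M (\<lambda>\<omega>. indicator {\<omega>. S t \<omega> = i} \<omega> * \<phi> (stock \<theta> (Suc t) \<omega>) (S (Suc t) \<omega>))"
      using borel_measurable_times[OF indicator_state_measurable[OF mem(1), of i] borel_measurable_integrable[OF int1]]
      by (rule Bochner_Integration.integrable_bound[OF int1]) (rule AE_I2, simp add: indicator_def)
    then show "expectation (\<lambda>\<omega>. indicator {\<omega>. S t \<omega> = i} \<omega> * \<phi> (stock \<theta> (Suc t) \<omega>) (S (Suc t) \<omega>))
      = (\<Sum>j\<in>UNIV. expectation (\<lambda>\<omega>. indicator {\<omega>. S t \<omega> = i \<and> S (Suc t) \<omega> = j} \<omega> * \<phi> (max (stock \<theta> t \<omega>) (\<theta> t i) - D t \<omega>) j))"
      using t by (subst expectation_eq_sum_fibres[where Y="S (Suc t)"])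
        (auto intro!: sum.cong Bochner_Integration.integral_cong simp: indicator_def stock_Suc)
  qed
  also have "\<dots> = (\<Sum>i\<in>UNIV. \<Sum>j\<in>UNIV. pmf (p i) j * expectation (\<lambda>\<omega>. indicator {\<omega>. S t \<omega> = i} \<omega> *
      (\<integral>d. \<phi> (max (stock \<theta> t \<omega>) (\<theta> t i) - d) j \<partial>dem i)))"
  proof (intro sum.cong refl)
    fix i j
    show "expectation (\<lambda>\<omega>. indicator {\<omega>. S t \<omega> = i \<and> S (Suc t) \<omega> = j} \<omega> * \<phi> (max (stock \<theta> t \<omega>) (\<theta> t i) - D t \<omega>) j) =
      pmf (p i) j * expectation (\<lambda>\<omega>. indicator {\<omega>. S t \<omega> = i} \<omega> * (\<integral>d. \<phi> (max (stock \<theta> t \<omega>) (\<theta> t i) - d) j \<partial>dem i))"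
    proof (rule expectation_conditionally_indep[OF demand_law, where K=K and X="stock \<theta> t" and Y="D t"
          and \<phi>="\<lambda>x d. \<phi> (max x (\<theta> t i) - d) j"])
      show "prob {\<omega> \<in> space M. stock \<theta> t \<omega> \<in> A \<and> D t \<omega> \<in> C \<and> S t \<omega> = i \<and> S (Suc t) \<omega> = j}
        = prob {\<omega> \<in> space M. stock \<theta> t \<omega> \<in> A \<and> S t \<omega> = i} * pmf (p i) j * measure (dem i) C"
        if "A \<in> sets borel" "C \<in> sets borel" for A C using transition_prob t that by auto
    qed (auto simp: bnd)
  qed
  also have "\<dots> = (\<Sum>i\<in>UNIV. expectation (\<lambda>\<omega>. indicator {\<omega>. S t \<omega> = i} \<omega> *
      (\<Sum>j\<in>UNIV. pmf (p i) j * (\<integral>d. \<phi> (max (stock \<theta> t \<omega>) (\<theta> t i) - d) j \<partial>dem i))))"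
  proof (rule sum.cong[OF refl])
    fix i
    have "integrable M (\<lambda>\<omega>. pmf (p i) j * (indicator {\<omega>. S t \<omega> = i} \<omega> * (\<integral>d. \<phi> (max (stock \<theta> t \<omega>) (\<theta> t i) - d) j \<partial>dem i)))" for j
      using indicator_state_measurable[OF mem(1), of i]
      by (intro integrable_mult_right integrable_const_bound[where B=K] borel_measurable_times)
        (auto simp: indicator_def bnd')
    then show "(\<Sum>j\<in>UNIV. pmf (p i) j * expectation (\<lambda>\<omega>. indicator {\<omega>. S t \<omega> = i} \<omega> *
      (\<integral>d. \<phi> (max (stock \<theta> t \<omega>) (\<theta> t i) - d) j \<partial>dem i))) = expectation (\<lambda>\<omega>. indicator {\<omega>. S t \<omega> = i} \<omega> *
      (\<Sum>j\<in>UNIV. pmf (p i) j * (\<integral>d. \<phi> (max (stock \<theta> t \<omega>) (\<theta> t i) - d) j \<partial>dem i)))"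
      by (simp add: sum_distrib_left mult.left_commute)
  qed
  also have "\<dots> = expectation (\<lambda>\<omega>. \<Sum>j\<in>UNIV. pmf (p (S t \<omega>)) j *
        (\<integral>d. \<phi> (max (stock \<theta> t \<omega>) (\<theta> t (S t \<omega>)) - d) j \<partial>dem (S t \<omega>)))"
    by (subst (2) expectation_eq_sum_fibres[where Y="S t"], measurable, fact int2)
      (intro sum.cong Bochner_Integration.integral_cong refl, auto simp: indicator_def)
  finally show ?thesis .
qed

text \<open>Cutting the argument of \<open>\<phi>\<close> off at an almost sure bound
  \<open>C\<close> of the inventories changes neither side and makes the function bounded.\<close>

lemma expectation_step:
  assumes t: "1 \<le> t" "t < T" and lb: "left_bounded \<phi>"
  shows "expectation (\<lambda>\<omega>. \<phi> (stock \<theta> (Suc t) \<omega>) (S (Suc t) \<omega>))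
    = expectation (\<lambda>\<omega>. \<Sum>j\<in>UNIV. pmf (p (S t \<omega>)) j *
        (\<integral>d. \<phi> (max (stock \<theta> t \<omega>) (\<theta> t (S t \<omega>)) - d) j \<partial>dem (S t \<omega>)))"
proof -
  have mem: "t \<in> {1..T}" "Suc t \<in> {1..T}" using t by auto
  have [measurable]: "\<And>j. (\<lambda>x. \<phi> x j) \<in> borel_measurable borel" using lb by (auto simp: left_bounded_def)
  obtain C where C: "B \<le> C" "\<And>r i. r \<in> {1..T} \<Longrightarrow> \<theta> r i \<le> C" using levels_bounded[of \<theta>] by blast
  obtain K where K: "\<And>x i. x \<le> C \<Longrightarrow> \<bar>\<phi> x i\<bar> \<le> K" using lb unfolding left_bounded_def by metis
  define \<psi> where "\<psi> x j = \<phi> (min x C) j" for x j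
  have [measurable]: "\<And>j. (\<lambda>x. \<psi> x j) \<in> borel_measurable borel" unfolding \<psi>_def by measurable
  have AE: "AE \<omega> in M. stock \<theta> t \<omega> \<le> C" "AE \<omega> in M. stock \<theta> (Suc t) \<omega> \<le> C"
    using AE_stock_le[of t C \<theta>] AE_stock_le[of "Suc t" C \<theta>] t C by auto
  note inventory.simps[simp del]
  have "expectation (\<lambda>\<omega>. \<phi> (stock \<theta> (Suc t) \<omega>) (S (Suc t) \<omega>)) = expectation (\<lambda>\<omega>. \<psi> (stock \<theta> (Suc t) \<omega>) (S (Suc t) \<omega>))"
  proof (rule integral_cong_AE)
    show "AE \<omega> in M. \<phi> (stock \<theta> (Suc t) \<omega>) (S (Suc t) \<omega>) = \<psi> (stock \<theta> (Suc t) \<omega>) (S (Suc t) \<omega>)"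
      using AE(2) by eventually_elim (simp add: \<psi>_def min_absorb1)
  qed (use state_measurable[OF mem(2), of "\<lambda>i x. \<phi> x i"] state_measurable[OF mem(2), of "\<lambda>i x. \<psi> x i"] in auto)
  also have "\<dots> = expectation (\<lambda>\<omega>. \<Sum>j\<in>UNIV. pmf (p (S t \<omega>)) j *
        (\<integral>d. \<psi> (max (stock \<theta> t \<omega>) (\<theta> t (S t \<omega>)) - d) j \<partial>dem (S t \<omega>)))"
    by (rule expectation_step_bounded[OF t, where K=K]) (auto simp: \<psi>_def K)
  also have "\<dots> = expectation (\<lambda>\<omega>. \<Sum>j\<in>UNIV. pmf (p (S t \<omega>)) j *
        (\<integral>d. \<phi> (max (stock \<theta> t \<omega>) (\<theta> t (S t \<omega>)) - d) j \<partial>dem (S t \<omega>)))"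
  proof (rule integral_cong_AE)
    show "AE \<omega> in M. (\<Sum>j\<in>UNIV. pmf (p (S t \<omega>)) j * (\<integral>d. \<psi> (max (stock \<theta> t \<omega>) (\<theta> t (S t \<omega>)) - d) j \<partial>dem (S t \<omega>)))
      = (\<Sum>j\<in>UNIV. pmf (p (S t \<omega>)) j * (\<integral>d. \<phi> (max (stock \<theta> t \<omega>) (\<theta> t (S t \<omega>)) - d) j \<partial>dem (S t \<omega>)))"
      using AE(1)
    proof eventually_elim
      case (elim \<omega>)
      let ?y = "max (stock \<theta> t \<omega>) (\<theta> t (S t \<omega>))"
      have y: "?y \<le> C" using elim C(2)[OF mem(1)] by auto
      have "(\<integral>d. \<psi> (?y - d) j \<partial>dem (S t \<omega>)) = (\<integral>d. \<phi> (?y - d) j \<partial>dem (S t \<omega>))" for j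
      proof (rule integral_cong_AE)
        show "AE d in dem (S t \<omega>). \<psi> (?y - d) j = \<phi> (?y - d) j"
          using demand_nonneg
        proof eventually_elim
          case (elim d)
          then have "min (?y - d) C = ?y - d" using y by linarith
          then show ?case by (simp only: \<psi>_def)
        qed
      qed measurable
      then show ?case by simp
    qed
  qed (use state_measurable[OF mem(1)] next_expectation_measurable[of \<psi>] next_expectation_measurable[of \<phi>]
      in \<open>auto intro!: state_measurable[OF mem(1), where \<Psi>="\<lambda>i x. \<Sum>j\<in>UNIV. pmf (p i) j * (\<integral>d. _ (max x (\<theta> t i) - d) j \<partial>dem i)"]\<close>)
  finally show ?thesis .
qed

section \<open>Costs-to-go and the performance difference\<close>

lemma dem_atomless: "measure (dem i) {x} = 0"
proof -
  interpret N: real_distribution "dem i" by (rule demand_law)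
  have "continuous_on UNIV (cdf (dem i))"
    by (rule lipschitz_on_continuous_on[OF dem_lipschitz])
  then show ?thesis by (simp add: continuous_on_eq_continuous_at N.isCont_cdf[symmetric])
qed

lemma stage_cost_regular:
  assumes t: "t \<in> {1..T}"
  shows "(h t + b t)-lipschitz_on UNIV (\<lambda>y. stage_cost h b dem t y i)" (is ?L)
    and "((\<lambda>y. stage_cost h b dem t y i) has_real_derivative (h t + b t) * cdf (dem i) y - b t) (at y)" (is ?D)
proof -
  interpret N: real_distribution "dem i" by (rule demand_law)
  define \<phi> where "\<phi> z = h t * max z 0 + b t * max (- z) 0" for z
  \<comment> \<open>With the value \<open>h t\<close> at 0, \<open>\<phi>' (y - d)\<close> equals
    \<open>h t\<close> exactly for \<open>d \<le> y\<close>, so that its mean is the newsvendor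
    formula in terms of the CDF.\<close>
  define \<phi>' where "\<phi>' z = (if 0 \<le> z then h t else - b t)" for z :: real
  have hb: "0 \<le> h t" "0 \<le> b t" using cost_nonneg[OF t] by auto
  have lip: "(h t + b t)-lipschitz_on UNIV \<phi>"
  proof (rule lipschitz_onI)
    fix x y :: real
    have "\<bar>\<phi> x - \<phi> y\<bar> = \<bar>h t * (max x 0 - max y 0) + b t * (max (- x) 0 - max (- y) 0)\<bar>"
      by (simp add: \<phi>_def algebra_simps)
    also have "\<dots> \<le> h t * \<bar>max x 0 - max y 0\<bar> + b t * \<bar>max (- x) 0 - max (- y) 0\<bar>"
      using hb by (intro order_trans[OF abs_triangle_ineq]) (simp add: abs_mult)
    also have "\<dots> \<le> h t * \<bar>x - y\<bar> + b t * \<bar>x - y\<bar>"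
      using hb by (intro add_mono mult_left_mono) auto
    finally show "dist (\<phi> x) (\<phi> y) \<le> (h t + b t) * dist x y" by (simp add: dist_real_def algebra_simps)
  qed (use hb in auto)
  have int: "integrable (dem i) (\<lambda>d. \<phi> (y - d))" for y
    unfolding \<phi>_def by (rule cost_finite[OF t])
  have deriv: "(\<phi> has_real_derivative \<phi>' z) (at z)" if "z \<noteq> 0" for z
  proof (cases "0 < z")
    case True
    have "((\<lambda>z. h t * z) has_real_derivative \<phi>' z) (at z)"
      using True by (auto intro!: derivative_eq_intros simp: \<phi>'_def)
    then show ?thesis
      by (rule has_field_derivative_transform_within_open[where S="{0<..}"]) (use True in \<open>auto simp: \<phi>_def max_def\<close>)
  next
    case False
    have "((\<lambda>z. - b t * z) has_real_derivative \<phi>' z) (at z)"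
      using False that by (auto intro!: derivative_eq_intros simp: \<phi>'_def)
    then show ?thesis
      by (rule has_field_derivative_transform_within_open[where S="{..<0}"]) (use False that in \<open>auto simp: \<phi>_def max_def\<close>)
  qed
  have [measurable]: "\<phi>' \<in> borel_measurable borel" unfolding \<phi>'_def by measurable
  have st: "(\<lambda>y. stage_cost h b dem t y i) = (\<lambda>y. \<integral>d. \<phi> (y - d) \<partial>dem i)"
    by (simp add: stage_cost_def \<phi>_def)
  show ?L unfolding st by (rule N.expectation_shift_lipschitz[OF lip int])
  have "(\<integral>d. \<phi>' (y - d) \<partial>dem i) = (\<integral>d. (h t + b t) * indicator {..y} d - b t \<partial>dem i)"
    by (rule Bochner_Integration.integral_cong) (auto simp: \<phi>'_def indicator_def)
  also have "\<dots> = (h t + b t) * cdf (dem i) y - b t"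
    by (subst Bochner_Integration.integral_diff) (auto simp: cdf_def Int_absorb1 N.emeasure_eq_measure)
  finally show ?D
    unfolding st using N.expectation_shift_deriv(2)[where c=0, OF lip int deriv _ dem_atomless, of y] by simp
qed

function cost_to_go :: "(nat \<Rightarrow> 'i \<Rightarrow> real) \<Rightarrow> nat \<Rightarrow> real \<Rightarrow> 'i \<Rightarrow> real" where
  "cost_to_go \<theta> t x i = (if T < t then 0 else stage_cost h b dem t (max x (\<theta> t i)) i +
     (\<Sum>j\<in>UNIV. pmf (p i) j * (\<integral>d. cost_to_go \<theta> (Suc t) (max x (\<theta> t i) - d) j \<partial>dem i)))"
  by pat_completeness auto
termination by (relation "Wellfounded.measure (\<lambda>(\<theta>, t, x, i). Suc T - t)") auto

declare cost_to_go.simps [simp del]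

text \<open>\<open>slope_to_go\<close> is the derivative of \<open>cost_to_go\<close> in the inventory, with value 0 at the kink.\<close>

function slope_to_go :: "(nat \<Rightarrow> 'i \<Rightarrow> real) \<Rightarrow> nat \<Rightarrow> real \<Rightarrow> 'i \<Rightarrow> real" where
  "slope_to_go \<theta> t x i = (if T < t then 0 else if x \<le> \<theta> t i then 0 else (h t + b t) * cdf (dem i) x - b t +
     (\<Sum>j\<in>UNIV. pmf (p i) j * (\<integral>d. slope_to_go \<theta> (Suc t) (x - d) j \<partial>dem i)))"
  by pat_completeness auto
termination by (relation "Wellfounded.measure (\<lambda>(\<theta>, t, x, i). Suc T - t)") auto

declare slope_to_go.simps [simp del]

text \<open>This is \<open>f\<^sub>t(y|i)\<close> for the fixed policy: \<open>y\<close> is the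
  inventory after ordering, whereas \<open>cost_to_go\<close> takes the inventory before
  ordering.\<close>

definition order_cost :: "(nat \<Rightarrow> 'i \<Rightarrow> real) \<Rightarrow> nat \<Rightarrow> real \<Rightarrow> 'i \<Rightarrow> real" where
  "order_cost \<theta> t y i = stage_cost h b dem t y i +
     (\<Sum>j\<in>UNIV. pmf (p i) j * (\<integral>d. cost_to_go \<theta> (Suc t) (y - d) j \<partial>dem i))"

definition order_slope :: "(nat \<Rightarrow> 'i \<Rightarrow> real) \<Rightarrow> nat \<Rightarrow> real \<Rightarrow> 'i \<Rightarrow> real" where
  "order_slope \<theta> t y i = (h t + b t) * cdf (dem i) y - b t +
     (\<Sum>j\<in>UNIV. pmf (p i) j * (\<integral>d. slope_to_go \<theta> (Suc t) (y - d) j \<partial>dem i))"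

lemma cost_to_go_eq: "t \<le> T \<Longrightarrow> cost_to_go \<theta> t x i = order_cost \<theta> t (max x (\<theta> t i)) i"
  by (subst cost_to_go.simps) (simp add: order_cost_def)

lemma slope_to_go_eq: "t \<le> T \<Longrightarrow> slope_to_go \<theta> t x i = (if x \<le> \<theta> t i then 0 else order_slope \<theta> t x i)"
  by (subst slope_to_go.simps) (simp add: order_slope_def)

lemma to_go_end: "cost_to_go \<theta> (Suc T) x i = 0" "slope_to_go \<theta> (Suc T) x i = 0"
  by (simp_all add: cost_to_go.simps slope_to_go.simps)

text \<open>For \<open>x \<le> C\<close> the point \<open>max x (c i)\<close> is within
  \<open>\<bar>C - c i\<bar>\<close> of \<open>c i\<close>, and the Lipschitz property bounds the
  function there. Summing over the finitely many states gives one bound for all.\<close>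

lemma lipschitz_left_bounded:
  assumes lip: "\<And>i. K-lipschitz_on UNIV (\<lambda>y. f y i)"
  shows "left_bounded (\<lambda>x i. f (max x (c i)) i)"
proof -
  have "continuous_on UNIV (\<lambda>y. f y i)" for i by (rule lipschitz_on_continuous_on[OF lip])
  then have [measurable]: "(\<lambda>y. f y i) \<in> borel_measurable borel" for i
    by (rule borel_measurable_continuous_onI)
  have "\<bar>f (max x (c i)) i\<bar> \<le> (\<Sum>j\<in>UNIV. \<bar>f (c j) j\<bar> + K * \<bar>C - c j\<bar>)" if "x \<le> C" for x i C
  proof -
    have K: "0 \<le> K" using lipschitz_on_nonneg[OF lip] .
    have "\<bar>f (max x (c i)) i - f (c i) i\<bar> \<le> K * \<bar>max x (c i) - c i\<bar>"
      using lipschitz_onD[OF lip, of "max x (c i)" "c i" i] by (simp add: dist_real_def)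
    also have "\<dots> \<le> K * \<bar>C - c i\<bar>" using that K by (intro mult_left_mono) auto
    finally have "\<bar>f (max x (c i)) i\<bar> \<le> \<bar>f (c i) i\<bar> + K * \<bar>C - c i\<bar>" by linarith
    also have "\<dots> \<le> (\<Sum>j\<in>UNIV. \<bar>f (c j) j\<bar> + K * \<bar>C - c j\<bar>)"
      using K by (intro member_le_sum[where f="\<lambda>j. \<bar>f (c j) j\<bar> + K * \<bar>C - c j\<bar>"]) auto
    finally show ?thesis .
  qed
  then show ?thesis unfolding left_bounded_def by (auto intro: exI)
qed

text \<open>The invariant of the backward induction over periods. The base-stock level, where
  ordering stops, is the only point at which \<open>cost_to_go\<close> may have a kink.\<close>

definition regular :: "(nat \<Rightarrow> 'i \<Rightarrow> real) \<Rightarrow> nat \<Rightarrow> bool" where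
  "regular \<theta> t \<longleftrightarrow> left_bounded (cost_to_go \<theta> t) \<and>
     (\<exists>K. \<forall>i. K-lipschitz_on UNIV (\<lambda>x. cost_to_go \<theta> t x i)) \<and>
     (\<forall>i x. x \<noteq> \<theta> t i \<longrightarrow> ((\<lambda>x. cost_to_go \<theta> t x i) has_real_derivative slope_to_go \<theta> t x i) (at x)) \<and>
     (\<forall>i. (\<lambda>x. slope_to_go \<theta> t x i) \<in> borel_measurable borel)"

text \<open>Averaging over an atomless demand removes the kinks of the next cost-to-go, so that
  \<open>order_cost\<close> is differentiable everywhere. The Lipschitz constants add up:
  \<open>h t + b t\<close> from the stage and \<open>K\<close> from the future.\<close>

lemma order_cost_regular:
  assumes t: "t \<in> {1..T}" and reg: "regular \<theta> (Suc t)"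
  shows "\<exists>K. \<forall>i. K-lipschitz_on UNIV (\<lambda>y. order_cost \<theta> t y i)" (is ?L)
    and "((\<lambda>y. order_cost \<theta> t y i) has_real_derivative order_slope \<theta> t y i) (at y)" (is ?D)
    and "integrable (dem i) (\<lambda>d. slope_to_go \<theta> (Suc t) (y - d) j)" (is ?I)
    and "(\<lambda>y. order_slope \<theta> t y i) \<in> borel_measurable borel" (is ?M)
proof -
  interpret N: real_distribution "dem k" for k by (rule demand_law)
  obtain K where K: "\<And>i. K-lipschitz_on UNIV (\<lambda>x. cost_to_go \<theta> (Suc t) x i)"
    using reg unfolding regular_def by auto
  have int: "integrable (dem i) (\<lambda>d. cost_to_go \<theta> (Suc t) (y - d) j)" for y i j
    using reg by (intro left_bounded_integrable_dem) (auto simp: regular_def)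
  have deriv: "((\<lambda>x. cost_to_go \<theta> (Suc t) x j) has_real_derivative slope_to_go \<theta> (Suc t) x j) (at x)"
    if "x \<noteq> \<theta> (Suc t) j" for x j using reg that by (auto simp: regular_def)
  have [measurable]: "(\<lambda>x. slope_to_go \<theta> (Suc t) x j) \<in> borel_measurable borel" for j
    using reg by (auto simp: regular_def)
  show ?I by (rule N.expectation_shift_deriv(1)[OF K int deriv _ dem_atomless]) auto
  have D: "((\<lambda>y. \<integral>d. cost_to_go \<theta> (Suc t) (y - d) j \<partial>dem i) has_real_derivative
      (\<integral>d. slope_to_go \<theta> (Suc t) (y - d) j \<partial>dem i)) (at y)" for i j y
    by (rule N.expectation_shift_deriv(2)[OF K int deriv _ dem_atomless]) auto
  show ?D unfolding order_cost_def order_slope_def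
    by (intro DERIV_add stage_cost_regular t DERIV_sum DERIV_cmult D)
  have "(h t + b t + K)-lipschitz_on UNIV (\<lambda>y. order_cost \<theta> t y i)" for i
  proof (rule lipschitz_onI)
    fix x y :: real
    define \<Delta> where "\<Delta> j = (\<integral>d. cost_to_go \<theta> (Suc t) (x - d) j \<partial>dem i) - (\<integral>d. cost_to_go \<theta> (Suc t) (y - d) j \<partial>dem i)" for j
    have "\<bar>\<Delta> j\<bar> \<le> K * \<bar>x - y\<bar>" for j
      using lipschitz_onD[OF N.expectation_shift_lipschitz[OF K int], of x y i j] by (simp add: \<Delta>_def dist_real_def)
    then have "\<bar>\<Sum>j\<in>UNIV. pmf (p i) j * \<Delta> j\<bar> \<le> (\<Sum>j\<in>UNIV. pmf (p i) j * (K * \<bar>x - y\<bar>))"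
      by (intro order_trans[OF sum_abs] sum_mono) (simp add: abs_mult mult_left_mono)
    also have "\<dots> = K * \<bar>x - y\<bar>" by (simp add: sum_distrib_right[symmetric] sum_pmf_eq_1)
    finally have "\<bar>\<Sum>j\<in>UNIV. pmf (p i) j * \<Delta> j\<bar> \<le> K * \<bar>x - y\<bar>" .
    moreover have "\<bar>stage_cost h b dem t x i - stage_cost h b dem t y i\<bar> \<le> (h t + b t) * \<bar>x - y\<bar>"
      using lipschitz_onD[OF stage_cost_regular(1)[OF t], of x y i] by (simp add: dist_real_def)
    moreover have "order_cost \<theta> t x i - order_cost \<theta> t y i =
        stage_cost h b dem t x i - stage_cost h b dem t y i + (\<Sum>j\<in>UNIV. pmf (p i) j * \<Delta> j)"
      by (simp add: order_cost_def \<Delta>_def right_diff_distrib sum_subtractf)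
    ultimately show "dist (order_cost \<theta> t x i) (order_cost \<theta> t y i) \<le> (h t + b t + K) * dist x y"
      by (simp add: dist_real_def algebra_simps abs_le_iff)
  qed (use cost_pos[OF t] lipschitz_on_nonneg[OF K] in auto)
  then show ?L by blast
  have "(\<lambda>y. \<integral>d. slope_to_go \<theta> (Suc t) (y - d) j \<partial>dem i) \<in> borel_measurable borel" for j
    by (rule N.borel_measurable_lebesgue_integral) measurable
  moreover have "cdf (dem i) \<in> borel_measurable borel"
    by (intro borel_measurable_continuous_onI lipschitz_on_continuous_on[OF dem_lipschitz])
  ultimately show ?M unfolding order_slope_def
    by (intro borel_measurable_add borel_measurable_diff borel_measurable_times borel_measurable_sum borel_measurable_const) auto
qed

text \<open>Backward induction: \<open>cost_to_go\<close> is \<open>order_cost\<close> after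
  \<open>max x (\<theta> t i)\<close>, hence constant left of the level and equal to the
  differentiable \<open>order_cost\<close> right of it.\<close>

lemma cost_to_go_regular:
  assumes "1 \<le> t" "t \<le> Suc T"
  shows "regular \<theta> t"
  using assms(2,1)
proof (induction t rule: inc_induct)
  case base
  have "\<exists>K. K-lipschitz_on UNIV (\<lambda>x::real. 0::real)" using lipschitz_on_constant by blast
  then show ?case by (auto simp: regular_def to_go_end left_bounded_def intro: exI[of _ 0])
next
  case (step t)
  then have t: "t \<in> {1..T}" and reg: "regular \<theta> (Suc t)" by auto
  note order = order_cost_regular[OF t reg]
  note [measurable] = order(4)
  obtain K where K: "\<And>i. K-lipschitz_on UNIV (\<lambda>y. order_cost \<theta> t y i)" using order(1) by auto
  have V: "cost_to_go \<theta> t = (\<lambda>x i. order_cost \<theta> t (max x (\<theta> t i)) i)"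
    using t by (auto simp: cost_to_go_eq fun_eq_iff)
  have G: "slope_to_go \<theta> t = (\<lambda>x i. if x \<le> \<theta> t i then 0 else order_slope \<theta> t x i)"
    using t by (auto simp: slope_to_go_eq fun_eq_iff)
  have "K-lipschitz_on UNIV (\<lambda>x. cost_to_go \<theta> t x i)" for i
  proof (rule lipschitz_onI)
    fix x y :: real
    have "dist (cost_to_go \<theta> t x i) (cost_to_go \<theta> t y i) \<le> K * dist (max x (\<theta> t i)) (max y (\<theta> t i))"
      unfolding V using lipschitz_onD[OF K] by blast
    also have "\<dots> \<le> K * dist x y"
      using lipschitz_on_nonneg[OF K] by (intro mult_left_mono) (auto simp: dist_real_def)
    finally show "dist (cost_to_go \<theta> t x i) (cost_to_go \<theta> t y i) \<le> K * dist x y" .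
  qed (rule lipschitz_on_nonneg[OF K])
  moreover have "((\<lambda>x. cost_to_go \<theta> t x i) has_real_derivative slope_to_go \<theta> t x i) (at x)"
    if "x \<noteq> \<theta> t i" for x i
  proof (cases "x < \<theta> t i")
    case True
    have "((\<lambda>x. order_cost \<theta> t (\<theta> t i) i) has_real_derivative 0) (at x)" by simp
    then have "((\<lambda>x. cost_to_go \<theta> t x i) has_real_derivative 0) (at x)"
      by (rule has_field_derivative_transform_within_open[where S="{..<\<theta> t i}"]) (use True in \<open>auto simp: V max_def\<close>)
    then show ?thesis using True by (simp add: G)
  next
    case False
    then have "\<theta> t i < x" using that by simp
    have "((\<lambda>x. cost_to_go \<theta> t x i) has_real_derivative order_slope \<theta> t x i) (at x)"
      using order(2)[of i x]
      by (rule has_field_derivative_transform_within_open[where S="{\<theta> t i<..}"]) (use \<open>\<theta> t i < x\<close> in \<open>auto simp: V max_def\<close>)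
    then show ?thesis using \<open>\<theta> t i < x\<close> by (simp add: G)
  qed
  moreover have "left_bounded (cost_to_go \<theta> t)" unfolding V by (rule lipschitz_left_bounded[OF K])
  moreover have "(\<lambda>x. slope_to_go \<theta> t x i) \<in> borel_measurable borel" for i unfolding G by measurable
  ultimately show ?case unfolding regular_def by blast
qed

lemmas order_cost_lipschitz = order_cost_regular(1)[OF _ cost_to_go_regular]
  and order_cost_deriv = order_cost_regular(2)[OF _ cost_to_go_regular]
  and slope_to_go_integrable = order_cost_regular(3)[OF _ cost_to_go_regular]

definition total_cost :: "(nat \<Rightarrow> 'i \<Rightarrow> real) \<Rightarrow> real" where
  "total_cost \<theta> = expectation (\<lambda>\<omega>. \<Sum>t = 1..T. stage_cost h b dem t (max (stock \<theta> t \<omega>) (\<theta> t (S t \<omega>))) (S t \<omega>))"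

lemma order_cost_left_bounded:
  assumes "t \<in> {1..T}"
  shows "left_bounded (\<lambda>x i. order_cost \<theta> t (max x (c i)) i)"
proof -
  obtain K where "\<And>i. K-lipschitz_on UNIV (\<lambda>y. order_cost \<theta> t y i)"
    using order_cost_lipschitz[of t \<theta>] assms by auto
  then show ?thesis by (rule lipschitz_left_bounded)
qed

lemma order_cost_integrable:
  "t \<in> {1..T} \<Longrightarrow> integrable M (\<lambda>\<omega>. order_cost \<theta> t (max (stock \<theta>' t \<omega>) (c (S t \<omega>))) (S t \<omega>))"
  using left_bounded_integrable[OF order_cost_left_bounded] by simp

text \<open>The expected cost-to-go \<open>e\<close> of \<open>\<theta>\<close> along the path of \<open>\<theta>'\<close> telescopes.\<close>

lemma total_cost_expansion:
  "total_cost \<theta>' = expectation (\<lambda>\<omega>. order_cost \<theta> 1 (max (X1 \<omega>) (\<theta> 1 (S 1 \<omega>))) (S 1 \<omega>)) +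
    (\<Sum>t = 1..T. expectation (\<lambda>\<omega>. order_cost \<theta> t (max (stock \<theta>' t \<omega>) (\<theta>' t (S t \<omega>))) (S t \<omega>)
       - order_cost \<theta> t (max (stock \<theta>' t \<omega>) (\<theta> t (S t \<omega>))) (S t \<omega>)))" if "1 \<le> T"
proof -
  \<comment> \<open>The value 0 after the horizon is set by hand, since nothing is known about
    \<open>S (Suc T)\<close>. For the same reason the last period is treated separately
    below.\<close>
  define e where "e t = (if t \<le> T then expectation (\<lambda>\<omega>. cost_to_go \<theta> t (stock \<theta>' t \<omega>) (S t \<omega>)) else 0)" for t
  define F where "F c t = expectation (\<lambda>\<omega>. order_cost \<theta> t (max (stock \<theta>' t \<omega>) (c t (S t \<omega>))) (S t \<omega>))" for c t
  have stage_int: "integrable M (\<lambda>\<omega>. stage_cost h b dem t (max (stock \<theta>' t \<omega>) (\<theta>' t (S t \<omega>))) (S t \<omega>))"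
    if "t \<in> {1..T}" for t
    using left_bounded_integrable[OF lipschitz_left_bounded[where f="stage_cost h b dem t", OF stage_cost_regular(1)[OF that]] that] by simp
  have "expectation (\<lambda>\<omega>. stage_cost h b dem t (max (stock \<theta>' t \<omega>) (\<theta>' t (S t \<omega>))) (S t \<omega>)) = F \<theta>' t - e (Suc t)"
    if t: "t \<in> {1..T}" for t
  proof (cases "t = T")
    case True
    then show ?thesis by (simp add: F_def e_def order_cost_def to_go_end)
  next
    case False
    with t have "1 \<le> t" "t < T" by auto
    have reg: "regular \<theta> (Suc t)" using t by (intro cost_to_go_regular) auto
    have "e (Suc t) = expectation (\<lambda>\<omega>. \<Sum>j\<in>UNIV. pmf (p (S t \<omega>)) j *
        (\<integral>d. cost_to_go \<theta> (Suc t) (max (stock \<theta>' t \<omega>) (\<theta>' t (S t \<omega>)) - d) j \<partial>dem (S t \<omega>)))"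
      using \<open>t < T\<close> expectation_step[OF \<open>1 \<le> t\<close> \<open>t < T\<close>, of "cost_to_go \<theta> (Suc t)" \<theta>'] reg
      by (simp add: e_def regular_def del: stock_Suc inventory.simps)
    also have "\<dots> = expectation (\<lambda>\<omega>. order_cost \<theta> t (max (stock \<theta>' t \<omega>) (\<theta>' t (S t \<omega>))) (S t \<omega>)
        - stage_cost h b dem t (max (stock \<theta>' t \<omega>) (\<theta>' t (S t \<omega>))) (S t \<omega>))"
      by (simp add: order_cost_def)
    also have "\<dots> = F \<theta>' t - expectation (\<lambda>\<omega>. stage_cost h b dem t (max (stock \<theta>' t \<omega>) (\<theta>' t (S t \<omega>))) (S t \<omega>))"
      unfolding F_def by (rule Bochner_Integration.integral_diff[OF order_cost_integrable[OF t] stage_int[OF t]])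
    finally show ?thesis by simp
  qed
  moreover have "e t = F \<theta> t" if "t \<in> {1..T}" for t
    using that by (simp add: e_def F_def cost_to_go_eq)
  ultimately have "total_cost \<theta>' = (\<Sum>t = 1..T. (F \<theta>' t - F \<theta> t) - (e (Suc t) - e t))"
    unfolding total_cost_def by (subst Bochner_Integration.integral_sum) (auto intro: stage_int sum.cong)
  also have "\<dots> = e 1 + (\<Sum>t = 1..T. F \<theta>' t - F \<theta> t)"
    using that sum_Suc_diff[of 1 T e]
    by (simp only: sum_subtractf[of "\<lambda>t. F \<theta>' t - F \<theta> t" "\<lambda>t. e (Suc t) - e t"]) (simp add: e_def)
  also have "F \<theta>' t - F \<theta> t = expectation (\<lambda>\<omega>. order_cost \<theta> t (max (stock \<theta>' t \<omega>) (\<theta>' t (S t \<omega>))) (S t \<omega>)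
       - order_cost \<theta> t (max (stock \<theta>' t \<omega>) (\<theta> t (S t \<omega>))) (S t \<omega>))" if "t \<in> {1..T}" for t
    unfolding F_def by (rule Bochner_Integration.integral_diff[symmetric]) (rule order_cost_integrable[OF that])+
  ultimately show ?thesis
    using that by (simp add: e_def cost_to_go_eq)
qed

text \<open>The expansion of \<open>total_cost \<theta>'\<close> minus that of
  \<open>total_cost \<theta>\<close>, both with respect to \<theta>: the initial terms agree, and in
  the second expansion every increment is 0.\<close>

lemma performance_difference:
  "total_cost \<theta>' - total_cost \<theta> = 
    (\<Sum>t = 1..T. expectation (\<lambda>\<omega>. order_cost \<theta> t (max (stock \<theta>' t \<omega>) (\<theta>' t (S t \<omega>))) (S t \<omega>)
       - order_cost \<theta> t (max (stock \<theta>' t \<omega>) (\<theta> t (S t \<omega>))) (S t \<omega>)))" if "1 \<le> T"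
  using total_cost_expansion[OF that, of \<theta>' \<theta>] total_cost_expansion[OF that, of \<theta> \<theta>] by simp

section \<open>The policy gradient\<close>

text \<open>The weight of the level \<open>\<theta> t i\<close> in the gradient: when the inventory
  lies above the level, a small change of the level has no effect in that period.\<close>

definition order_prob :: "(nat \<Rightarrow> 'i \<Rightarrow> real) \<Rightarrow> nat \<Rightarrow> 'i \<Rightarrow> real" where
  "order_prob \<theta> t i = prob {\<omega> \<in> space M. stock \<theta> t \<omega> \<le> \<theta> t i \<and> S t \<omega> = i}"

text \<open>In the first period the initial law puts mass \<alpha> on inventories up to 0. Later, a
  demand above \<open>B\<close> in the previous period pushes the inventory, at most
  \<open>B\<close> after ordering, below 0 and so below every level. This has probability at least
  \<alpha> given the previous state, and stationarity turns the sum over previous states into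
  \<open>pmf \<nu> i\<close>.\<close>

lemma order_prob_ge:
  assumes t: "t \<in> {1..T}" and \<theta>: "\<And>r i. r \<in> {1..T} \<Longrightarrow> \<theta> r i \<in> {0..B}"
  shows "\<alpha> * pmf \<nu> i \<le> order_prob \<theta> t i"
proof (cases "t = 1")
  case True
  interpret X: real_distribution "distr M borel X1" by (rule real_distribution_distr) simp
  have "order_prob \<theta> 1 i = prob {\<omega> \<in> space M. X1 \<omega> \<in> {..\<theta> 1 i} \<and> (\<forall>r\<in>{1..1}. S r \<omega> = i \<and> D r \<omega> \<in> UNIV)}"
    unfolding order_prob_def by (intro arg_cong[where f=prob]) auto
  also have "\<dots> = prob {\<omega> \<in> space M. X1 \<omega> \<in> {..\<theta> 1 i}} * pmf \<nu> i"
    using t path_prob[of 1 "\<lambda>_. UNIV" "\<lambda>_. i"] by (subst X1_path_prob) auto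
  also have "prob {\<omega> \<in> space M. X1 \<omega> \<in> {..\<theta> 1 i}} = \<rho> (\<theta> 1 i)"
    by (simp add: X1_cdf[symmetric] cdf_def measure_distr vimage_def Int_def conj_commute)
  finally have "order_prob \<theta> 1 i = \<rho> (\<theta> 1 i) * pmf \<nu> i" .
  moreover have "\<alpha> \<le> \<rho> (\<theta> 1 i)"
    using \<rho>_ge X.cdf_nondecreasing[of 0 "\<theta> 1 i"] \<theta>[of 1 i] t by (auto simp: X1_cdf)
  ultimately show ?thesis using True by (simp add: mult_right_mono)
next
  case False
  then obtain s where s: "t = Suc s" "1 \<le> s" "s < T" using t by (cases t) auto
  have mem: "s \<in> {1..T}" using s by auto
  note [measurable] = S_measurable[OF mem] S_measurable[OF t] S_measurable[OF t, unfolded s(1)] D_measurable[OF mem]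
  have [measurable]: "stock \<theta> t \<in> borel_measurable M" "stock \<theta> s \<in> borel_measurable M"
    using t mem by (auto intro!: stock_measurable simp del: inventory.simps)
  have AE: "AE \<omega> in M. stock \<theta> s \<omega> \<le> B"
    using \<theta> s by (intro AE_stock_le) auto
  have tail: "\<alpha> \<le> measure (dem k) {B<..}" for k
  proof -
    interpret N: real_distribution "dem k" by (rule demand_law)
    have "measure (dem k) {B<..} = 1 - cdf (dem k) B"
      using N.prob_compl[of "{..B}"] by (simp add: cdf_def Compl_eq_Diff_UNIV[symmetric] Compl_atMost)
    then show ?thesis using dem_le[of k] by simp
  qed
  have "\<alpha> * pmf \<nu> i = (\<Sum>k\<in>UNIV. pmf \<nu> k * pmf (p k) i * \<alpha>)"
    by (simp add: sum_distrib_right[symmetric] stationary_sum)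
  also have "\<dots> \<le> (\<Sum>k\<in>UNIV. pmf \<nu> k * pmf (p k) i * measure (dem k) {B<..})"
    using tail by (intro sum_mono mult_left_mono) auto
  also have "\<dots> = (\<Sum>k\<in>UNIV. prob {\<omega> \<in> space M. (D s \<omega> \<in> {B<..} \<and> S (Suc s) \<omega> = i) \<and> S s \<omega> = k})"
  proof (rule sum.cong[OF refl])
    fix k
    have "prob {\<omega> \<in> space M. (D s \<omega> \<in> {B<..} \<and> S (Suc s) \<omega> = i) \<and> S s \<omega> = k}
      = prob {\<omega> \<in> space M. stock \<theta> s \<omega> \<in> UNIV \<and> D s \<omega> \<in> {B<..} \<and> S s \<omega> = k \<and> S (Suc s) \<omega> = i}"
      by (intro arg_cong[where f=prob]) auto
    also have "\<dots> = pmf \<nu> k * pmf (p k) i * measure (dem k) {B<..}"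
      using s state_prob[of s k] by (subst transition_prob) auto
    finally show "pmf \<nu> k * pmf (p k) i * measure (dem k) {B<..}
      = prob {\<omega> \<in> space M. (D s \<omega> \<in> {B<..} \<and> S (Suc s) \<omega> = i) \<and> S s \<omega> = k}" by simp
  qed
  also have "\<dots> = prob {\<omega> \<in> space M. D s \<omega> \<in> {B<..} \<and> S (Suc s) \<omega> = i}"
    by (rule prob_eq_sum_fibres[symmetric]) measurable
  also have "\<dots> \<le> order_prob \<theta> t i"
    unfolding order_prob_def
  proof (rule finite_measure_mono_AE)
    show "AE \<omega> in M. \<omega> \<in> {\<omega> \<in> space M. D s \<omega> \<in> {B<..} \<and> S (Suc s) \<omega> = i} \<longrightarrow>
      \<omega> \<in> {\<omega> \<in> space M. stock \<theta> t \<omega> \<le> \<theta> t i \<and> S t \<omega> = i}"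
      using AE
    proof eventually_elim
      case (elim \<omega>)
      have "\<theta> s (S s \<omega>) \<le> B" "0 \<le> \<theta> t i" using \<theta>[of s "S s \<omega>"] \<theta>[of t i] mem t by auto
      then show ?case using elim s by auto
    qed
  qed (measurable)
  finally show ?thesis .
qed

text \<open>The initial inventory or, later, the preceding demand has a Lipschitz CDF, so the mass
  near a state-dependent point is at most of the order of the width. Differentiability of the cost
  only asks that \<open>C\<close> be the same for all \<epsilon>.\<close>

lemma stock_concentration:
  assumes t: "t \<in> {1..T}"
  obtains C where "0 \<le> C" "\<And>\<epsilon>. 0 < \<epsilon> \<Longrightarrow> prob {\<omega> \<in> space M. \<bar>stock \<theta> t \<omega> - c (S t \<omega>)\<bar> \<le> \<epsilon>} \<le> C * \<epsilon>"
proof (cases "t = 1")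
  case True
  interpret X: real_distribution "distr M borel X1" by (rule real_distribution_distr) simp
  have lip: "L\<^sub>\<rho>-lipschitz_on UNIV (cdf (distr M borel X1))" by (simp add: X1_cdf \<rho>_lipschitz)
  note [measurable] = S_measurable[OF t]
  have [measurable]: "(\<lambda>\<omega>. c (S t \<omega>)) \<in> borel_measurable M"
    by (rule measurable_compose[OF S_measurable[OF t]]) simp
  \<comment> \<open>The number of states appears because on each fibre of the state the probability
    is bounded by the unrestricted one for \<open>X1\<close>.\<close>
  have "prob {\<omega> \<in> space M. \<bar>stock \<theta> t \<omega> - c (S t \<omega>)\<bar> \<le> \<epsilon>} \<le> real CARD('i) * (3 * L\<^sub>\<rho>) * \<epsilon>" if "0 < \<epsilon>" for \<epsilon>
  proof -
    have meas: "{\<omega> \<in> space M. \<bar>X1 \<omega> - c (S t \<omega>)\<bar> \<le> \<epsilon>} \<in> events" by measurable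
    have "prob {\<omega> \<in> space M. \<bar>stock \<theta> t \<omega> - c (S t \<omega>)\<bar> \<le> \<epsilon>}
      = (\<Sum>i\<in>UNIV. prob {\<omega> \<in> space M. \<bar>X1 \<omega> - c (S t \<omega>)\<bar> \<le> \<epsilon> \<and> S t \<omega> = i})"
      using prob_eq_sum_fibres[OF S_measurable[OF t] meas] True by simp
    also have "\<dots> \<le> (\<Sum>i\<in>(UNIV::'i set). 3 * L\<^sub>\<rho> * \<epsilon>)"
    proof (rule sum_mono)
      fix i
      have "prob {\<omega> \<in> space M. \<bar>X1 \<omega> - c (S t \<omega>)\<bar> \<le> \<epsilon> \<and> S t \<omega> = i} \<le> prob (X1 -` {c i - \<epsilon>..c i + \<epsilon>} \<inter> space M)"
        by (rule finite_measure_mono) auto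
      also have "\<dots> = X.prob {c i - \<epsilon>..c i + \<epsilon>}" by (simp add: measure_distr)
      also have "\<dots> \<le> 3 * L\<^sub>\<rho> * \<epsilon>" by (rule X.interval_prob_le[OF lip that])
      finally show "prob {\<omega> \<in> space M. \<bar>X1 \<omega> - c (S t \<omega>)\<bar> \<le> \<epsilon> \<and> S t \<omega> = i} \<le> 3 * L\<^sub>\<rho> * \<epsilon>" .
    qed
    finally show ?thesis by simp
  qed
  moreover have "0 \<le> L\<^sub>\<rho>" using lipschitz_on_nonneg[OF \<rho>_lipschitz] .
  ultimately show ?thesis by (intro that[of "real CARD('i) * (3 * L\<^sub>\<rho>)"]) auto
next
  case False
  then obtain s where s: "t = Suc s" "1 \<le> s" "s < T" using t by (cases t) auto
  have LD: "0 \<le> L\<^sub>D" using lipschitz_on_nonneg[OF dem_lipschitz] .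
  have "prob {\<omega> \<in> space M. \<bar>stock \<theta> t \<omega> - c (S t \<omega>)\<bar> \<le> \<epsilon>} \<le> 3 * L\<^sub>D * \<epsilon>" if "0 < \<epsilon>" for \<epsilon>
  proof -
    define \<phi> where "\<phi> x j = (indicator {c j - \<epsilon>..c j + \<epsilon>} x :: real)" for x j
    define K where "K y i = (\<Sum>j\<in>UNIV. pmf (p i) j * (\<integral>d. \<phi> (y - d) j \<partial>dem i))" for y i
    have lb: "left_bounded \<phi>" by (auto simp: left_bounded_def \<phi>_def indicator_def intro!: exI[of _ 1])
    have "(\<integral>d. \<phi> (y - d) j \<partial>dem i) \<le> 3 * L\<^sub>D * \<epsilon>" for y i j
    proof -
      interpret N: real_distribution "dem i" by (rule demand_law)
      have "(\<integral>d. \<phi> (y - d) j \<partial>dem i) = (\<integral>d. indicator {(y - c j) - \<epsilon>..(y - c j) + \<epsilon>} d \<partial>dem i)"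
        by (rule Bochner_Integration.integral_cong) (auto simp: \<phi>_def indicator_def)
      also have "\<dots> = N.prob {(y - c j) - \<epsilon>..(y - c j) + \<epsilon>}" by simp
      also have "\<dots> \<le> 3 * L\<^sub>D * \<epsilon>" by (rule N.interval_prob_le[OF dem_lipschitz that])
      finally show ?thesis .
    qed
    then have "K y i \<le> (\<Sum>j\<in>UNIV. pmf (p i) j * (3 * L\<^sub>D * \<epsilon>))" for y i
      unfolding K_def by (intro sum_mono mult_left_mono) auto
    also have "\<And>i. (\<Sum>j\<in>UNIV. pmf (p i) j * (3 * L\<^sub>D * \<epsilon>)) = 3 * L\<^sub>D * \<epsilon>"
      by (simp add: sum_distrib_right[symmetric] sum_pmf_eq_1)
    finally have K: "K y i \<le> 3 * L\<^sub>D * \<epsilon>" for y i .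
    have "prob {\<omega> \<in> space M. \<bar>stock \<theta> t \<omega> - c (S t \<omega>)\<bar> \<le> \<epsilon>}
        = expectation (indicator {\<omega> \<in> space M. \<bar>stock \<theta> t \<omega> - c (S t \<omega>)\<bar> \<le> \<epsilon>})"
      by (simp add: Int_absorb2 subset_eq)
    also have "\<dots> = expectation (\<lambda>\<omega>. \<phi> (stock \<theta> (Suc s) \<omega>) (S (Suc s) \<omega>))"
      by (rule Bochner_Integration.integral_cong) (auto simp: \<phi>_def indicator_def s simp del: inventory.simps)
    also have "\<dots> = expectation (\<lambda>\<omega>. K (max (stock \<theta> s \<omega>) (\<theta> s (S s \<omega>))) (S s \<omega>))"
      unfolding K_def by (rule expectation_step[OF s(2,3) lb])
    also have "\<dots> \<le> expectation (\<lambda>\<omega>. 3 * L\<^sub>D * \<epsilon>)"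
      using K LD that by (intro Bochner_Integration.integral_mono') auto
    finally show ?thesis using prob_space by simp
  qed
  then show ?thesis using LD by (intro that[of "3 * L\<^sub>D"]) auto
qed

text \<open>A pathwise induction: \<open>max\<close> moves by at most the larger change of its
  arguments, and both systems subtract the same demand.\<close>

lemma stock_nonexpansive:
  assumes "\<And>r i. r \<in> {1..T} \<Longrightarrow> \<bar>\<theta>' r i - \<theta> r i\<bar> \<le> \<delta>" "0 \<le> \<delta>" "t \<le> Suc T"
  shows "\<bar>stock \<theta>' t \<omega> - stock \<theta> t \<omega>\<bar> \<le> \<delta>"
  using \<open>t \<le> Suc T\<close>
proof (induction t)
  case (Suc t)
  show ?case
  proof (cases "t = 0")
    case False
    then have "\<bar>\<theta>' t (S t \<omega>) - \<theta> t (S t \<omega>)\<bar> \<le> \<delta>" "\<bar>stock \<theta>' t \<omega> - stock \<theta> t \<omega>\<bar> \<le> \<delta>"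
      using Suc assms(1) by auto
    then show ?thesis using False by (simp add: max_def abs_le_iff)
  qed (use assms in auto)
qed (use assms in auto)

text \<open>Outside the event \<open>\<bar>x\<^sub>t - \<theta>\<^sub>t\<bar> \<le> 2 \<delta>\<close>, of probability \<open>O(\<delta>)\<close>, moving the policy by \<open>\<delta>\<close> does not change
  whether an order is placed; on it the integrand is \<open>O(\<delta>)\<close>.\<close>

lemma period_has_derivative:
  fixes x :: "real^'i^'t::finite" and tm :: "nat \<Rightarrow> 't"
  defines "lev \<equiv> \<lambda>(x :: real^'i^'t) t i. x $ tm t $ i"
  assumes t: "t \<in> {1..T}"
  shows "((\<lambda>x'. expectation (\<lambda>\<omega>. order_cost (lev x) t (max (stock (lev x') t \<omega>) (lev x' t (S t \<omega>))) (S t \<omega>)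
       - order_cost (lev x) t (max (stock (lev x') t \<omega>) (lev x t (S t \<omega>))) (S t \<omega>))) has_derivative
    (\<lambda>v. \<Sum>i\<in>UNIV. order_prob (lev x) t i * order_slope (lev x) t (lev x t i) i * v $ tm t $ i)) (at x)"
    (is "(?f has_derivative ?f') _")
  unfolding has_derivative_at_alt
proof (intro conjI allI impI)
  show "bounded_linear ?f'"
    by (intro bounded_linear_sum bounded_linear_mult_right[THEN bounded_linear_compose]
        bounded_linear_compose[OF bounded_linear_vec_nth] bounded_linear_vec_nth)
  define \<theta> where "\<theta> = lev x"
  define s where "s i = order_slope \<theta> t (\<theta> t i) i" for i
  \<comment> \<open>Cost function and slopes are frozen at the base point; only the path and the
    levels of \<open>x'\<close> move.\<close>
  define F where "F = order_cost \<theta> t"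
  obtain K where K: "\<And>i. K-lipschitz_on UNIV (\<lambda>y. F y i)"
    using order_cost_lipschitz[of t \<theta>] t unfolding F_def by auto
  have K0: "0 \<le> K" using lipschitz_on_nonneg[OF K] .
  define K' where "K' = K + (\<Sum>i\<in>UNIV. \<bar>s i\<bar>)"
  have K': "K + \<bar>s i\<bar> \<le> K'" for i
    unfolding K'_def by (intro add_left_mono member_le_sum) auto
  have K'0: "0 \<le> K'" using K' K0 by (meson abs_ge_zero add_nonneg_nonneg order_trans)
  obtain C where C0: "0 \<le> C" and C: "\<And>\<epsilon>. 0 < \<epsilon> \<Longrightarrow> prob {\<omega> \<in> space M. \<bar>stock \<theta> t \<omega> - \<theta> t (S t \<omega>)\<bar> \<le> \<epsilon>} \<le> C * \<epsilon>"
    using stock_concentration[OF t, of \<theta> "\<theta> t"] by blast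
  fix e :: real assume "0 < e"
  have "\<exists>d>0. \<forall>z. \<bar>z - \<theta> t i\<bar> < d \<longrightarrow> \<bar>F z i - F (\<theta> t i) i - s i * (z - \<theta> t i)\<bar> \<le> e / 2 * \<bar>z - \<theta> t i\<bar>" for i
  proof -
    have "((\<lambda>z. F z i) has_derivative (*) (s i)) (at (\<theta> t i))"
      using order_cost_deriv[of t \<theta> i "\<theta> t i"] t unfolding F_def s_def has_field_derivative_def by auto
    then show ?thesis
      using \<open>0 < e\<close> unfolding has_derivative_at_alt real_norm_def by (metis half_gt_zero)
  qed
  then obtain d where d: "\<And>i. 0 < d i"
    "\<And>i z. \<bar>z - \<theta> t i\<bar> < d i \<Longrightarrow> \<bar>F z i - F (\<theta> t i) i - s i * (z - \<theta> t i)\<bar> \<le> e / 2 * \<bar>z - \<theta> t i\<bar>"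
    by metis
  \<comment> \<open>Below the first bound the linear approximation of \<open>F\<close> has relative
    error \<open>e / 2\<close>. The second keeps the contribution
    \<open>K' * \<delta> * (C * (2 * \<delta>))\<close> of the event \<open>Z\<close> below
    \<open>e / 2 * \<delta>\<close>; the summand 1 prevents a division by 0.\<close>
  define d0 where "d0 = min (Min (range d)) (e / (4 * K' * C + 1))"
  have "0 \<le> 4 * K' * C" using K'0 C0 by simp
  then have "0 < e / (4 * K' * C + 1)" using \<open>0 < e\<close> by (intro divide_pos_pos) linarith+
  then have "0 < d0" using d(1) by (auto simp: d0_def)
  moreover have "norm (?f x' - ?f x - ?f' (x' - x)) \<le> e * norm (x' - x)" if "norm (x' - x) < d0" for x'
  proof (cases "x' = x")
    case False
    define \<delta> where "\<delta> = norm (x' - x)"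
    define \<theta>' where "\<theta>' = lev x'"
    have \<delta>: "0 < \<delta>" "\<delta> < d0" using False that by (auto simp: \<delta>_def)
    have close: "\<bar>\<theta>' r i - \<theta> r i\<bar> \<le> \<delta>" for r i
    proof -
      have "\<bar>(x' - x) $ tm r $ i\<bar> \<le> norm ((x' - x) $ tm r)" by (rule component_le_norm_cart)
      also have "\<dots> \<le> \<delta>" unfolding \<delta>_def by (rule Finite_Cartesian_Product.norm_nth_le)
      finally show ?thesis by (simp add: \<theta>_def \<theta>'_def lev_def)
    qed
    define A where "A \<omega> = F (max (stock \<theta>' t \<omega>) (\<theta>' t (S t \<omega>))) (S t \<omega>) - F (max (stock \<theta>' t \<omega>) (\<theta> t (S t \<omega>))) (S t \<omega>)" for \<omega>
    \<comment> \<open>\<open>R\<close> is the linear part of \<open>A\<close>, and its expectation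
      is the claimed derivative in direction \<open>x' - x\<close>.\<close>
    define R where "R \<omega> = indicator {\<omega>. stock \<theta> t \<omega> \<le> \<theta> t (S t \<omega>)} \<omega> * (s (S t \<omega>) * (\<theta>' t (S t \<omega>) - \<theta> t (S t \<omega>)))" for \<omega>
    define Z where "Z = {\<omega> \<in> space M. \<bar>stock \<theta> t \<omega> - \<theta> t (S t \<omega>)\<bar> \<le> 2 * \<delta>}"
    note [measurable] = S_measurable[OF t]
    have [measurable]: "stock \<theta> t \<in> borel_measurable M" using t by (intro stock_measurable) auto
    have fS[measurable]: "(\<lambda>\<omega>. g (S t \<omega>)) \<in> borel_measurable M" for g :: "'i \<Rightarrow> real"
      by (rule measurable_compose[OF S_measurable[OF t]]) simp
    have [measurable]: "Z \<in> events" unfolding Z_def by measurable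
    have Aint: "integrable M A"
      unfolding A_def F_def by (intro Bochner_Integration.integrable_diff order_cost_integrable t)
    have R_le: "\<bar>R \<omega>\<bar> \<le> K' * \<delta>" for \<omega>
    proof -
      have "\<bar>R \<omega>\<bar> \<le> \<bar>s (S t \<omega>)\<bar> * \<bar>\<theta>' t (S t \<omega>) - \<theta> t (S t \<omega>)\<bar>"
        by (auto simp: R_def abs_mult indicator_def)
      also have "\<dots> \<le> K' * \<delta>"
        using K'[of "S t \<omega>"] K0 close by (intro mult_mono) auto
      finally show ?thesis .
    qed
    have "{\<omega> \<in> space M. stock \<theta> t \<omega> \<le> \<theta> t (S t \<omega>)} \<in> events" by measurable
    then have Rm: "R \<in> borel_measurable M"
      unfolding R_def by (subst measurable_cong[where g="\<lambda>\<omega>. indicator {\<omega> \<in> space M. stock \<theta> t \<omega> \<le> \<theta> t (S t \<omega>)} \<omega> * (s (S t \<omega>) * (\<theta>' t (S t \<omega>) - \<theta> t (S t \<omega>)))"])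
        (auto simp: indicator_def intro!: borel_measurable_times borel_measurable_diff fS)
    then have Rint: "integrable M R"
      by (rule integrable_const_bound[where B="K' * \<delta>", rotated]) (use R_le in auto)
    have [simp]: "integrable M (indicator Z :: 'w \<Rightarrow> real)"
      by (intro integrable_real_indicator) (auto simp: emeasure_eq_measure)
    have Zint: "integrable M (\<lambda>\<omega>. e / 2 * \<delta> + K' * \<delta> * indicator Z \<omega>)"
      by (intro Bochner_Integration.integrable_add integrable_const integrable_mult_right) simp
    have pointwise: "\<bar>A \<omega> - R \<omega>\<bar> \<le> e / 2 * \<delta> + K' * \<delta> * indicator Z \<omega>" if "\<omega> \<in> space M" for \<omega>
    proof -
      define i where "i = S t \<omega>"
      define u u' where "u = stock \<theta> t \<omega>" and "u' = stock \<theta>' t \<omega>"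
      have uu: "\<bar>u' - u\<bar> \<le> \<delta>"
        unfolding u_def u'_def using close \<delta> t by (intro stock_nonexpansive) auto
      have cl: "\<bar>\<theta>' t i - \<theta> t i\<bar> \<le> \<delta>" by (rule close)
      have A: "A \<omega> = F (max u' (\<theta>' t i)) i - F (max u' (\<theta> t i)) i" by (simp add: A_def u'_def i_def)
      have R: "R \<omega> = (if u \<le> \<theta> t i then s i * (\<theta>' t i - \<theta> t i) else 0)" by (simp add: R_def u_def i_def)
      \<comment> \<open>Either the inventory is close to the level, or both policies order, or
        neither does. In the last case \<open>A\<close> and \<open>R\<close> both vanish.\<close>
      consider "\<bar>u - \<theta> t i\<bar> \<le> 2 * \<delta>" | "u < \<theta> t i - 2 * \<delta>" | "\<theta> t i + 2 * \<delta> < u" by linarith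
      then show ?thesis
      proof cases
        case 1
        then have "indicator Z \<omega> = (1::real)" using that by (simp add: Z_def u_def i_def)
        have "\<bar>A \<omega>\<bar> \<le> K * \<bar>max u' (\<theta>' t i) - max u' (\<theta> t i)\<bar>"
          using lipschitz_onD[OF K, of "max u' (\<theta>' t i)" "max u' (\<theta> t i)" i] by (simp add: A dist_real_def)
        also have "\<dots> \<le> K * \<delta>" using cl K0 by (intro mult_left_mono) auto
        finally have "\<bar>A \<omega>\<bar> \<le> K * \<delta>" .
        moreover have "\<bar>R \<omega>\<bar> \<le> \<bar>s i\<bar> * \<delta>" using cl by (auto simp: R abs_mult intro: mult_left_mono)
        moreover have "(K + \<bar>s i\<bar>) * \<delta> \<le> K' * \<delta>" using K' \<delta> by (intro mult_right_mono) auto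
        ultimately have "\<bar>A \<omega> - R \<omega>\<bar> \<le> K' * \<delta>" by (simp add: algebra_simps)
        also have "\<dots> \<le> e / 2 * \<delta> + K' * \<delta> * indicator Z \<omega>"
          using \<open>indicator Z \<omega> = 1\<close> \<open>0 < e\<close> \<delta> by simp
        finally show ?thesis .
      next
        case 2
        have "\<delta> < d i" using \<delta>(2) by (simp add: d0_def)
        then have "\<bar>\<theta>' t i - \<theta> t i\<bar> < d i" using cl by linarith
        then have "\<bar>F (\<theta>' t i) i - F (\<theta> t i) i - s i * (\<theta>' t i - \<theta> t i)\<bar> \<le> e / 2 * \<bar>\<theta>' t i - \<theta> t i\<bar>"
          by (rule d(2))
        also have "\<dots> \<le> e / 2 * \<delta>" using cl \<open>0 < e\<close> by (intro mult_left_mono) auto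
        finally have "\<bar>F (\<theta>' t i) i - F (\<theta> t i) i - s i * (\<theta>' t i - \<theta> t i)\<bar> \<le> e / 2 * \<delta>" .
        moreover have "u' \<le> \<theta> t i" "u' \<le> \<theta>' t i" "u \<le> \<theta> t i" using 2 uu cl \<delta> by linarith+
        moreover have "0 \<le> K' * \<delta> * indicator Z \<omega>" using K'0 \<delta> by simp
        ultimately show ?thesis by (simp add: A R max_absorb2)
      next
        case 3
        then have "\<theta> t i \<le> u'" "\<theta>' t i \<le> u'" "\<not> u \<le> \<theta> t i" using uu cl \<delta> by linarith+
        then show ?thesis using K'0 \<delta> \<open>0 < e\<close> by (simp add: A R max_absorb1)
      qed
    qed
    have "expectation R = ?f' (x' - x)"
    proof -
      have "expectation R = (\<Sum>i\<in>UNIV. expectation (\<lambda>\<omega>. indicator {\<omega>. S t \<omega> = i} \<omega> * R \<omega>))"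
        by (rule expectation_eq_sum_fibres[OF S_measurable[OF t] Rint])
      also have "\<dots> = (\<Sum>i\<in>UNIV. expectation (\<lambda>\<omega>. indicator {\<omega> \<in> space M. stock \<theta> t \<omega> \<le> \<theta> t i \<and> S t \<omega> = i} \<omega> * (s i * (\<theta>' t i - \<theta> t i))))"
        by (intro sum.cong Bochner_Integration.integral_cong refl) (auto simp: R_def indicator_def)
      also have "\<dots> = (\<Sum>i\<in>UNIV. order_prob \<theta> t i * (s i * (\<theta>' t i - \<theta> t i)))"
      proof (rule sum.cong[OF refl])
        fix i
        have "{\<omega> \<in> space M. stock \<theta> t \<omega> \<le> \<theta> t i \<and> S t \<omega> = i} \<in> events" by measurable
        then show "expectation (\<lambda>\<omega>. indicator {\<omega> \<in> space M. stock \<theta> t \<omega> \<le> \<theta> t i \<and> S t \<omega> = i} \<omega> * (s i * (\<theta>' t i - \<theta> t i)))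
          = order_prob \<theta> t i * (s i * (\<theta>' t i - \<theta> t i))"
          by (simp add: order_prob_def Int_absorb1)
      qed
      also have "\<dots> = ?f' (x' - x)" by (simp add: \<theta>_def \<theta>'_def lev_def s_def mult.assoc)
      finally show ?thesis .
    qed
    moreover have "?f x' = expectation A" by (simp add: A_def[abs_def] F_def \<theta>_def \<theta>'_def)
    moreover have "?f x = 0" by simp
    ultimately have "norm (?f x' - ?f x - ?f' (x' - x)) = \<bar>expectation (\<lambda>\<omega>. A \<omega> - R \<omega>)\<bar>"
      by (simp add: Bochner_Integration.integral_diff[OF Aint Rint])
    also have "\<dots> \<le> expectation (\<lambda>\<omega>. \<bar>A \<omega> - R \<omega>\<bar>)" by (rule integral_abs_bound)
    also have "\<dots> \<le> expectation (\<lambda>\<omega>. e / 2 * \<delta> + K' * \<delta> * indicator Z \<omega>)"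
      by (intro integral_mono Zint integrable_abs Bochner_Integration.integrable_diff Aint Rint pointwise)
    also have "\<dots> = e / 2 * \<delta> + K' * \<delta> * prob Z"
      by (subst Bochner_Integration.integral_add) (auto simp: prob_space Int_absorb1)
    also have "\<dots> \<le> e / 2 * \<delta> + K' * \<delta> * (C * (2 * \<delta>))"
      using C[of "2 * \<delta>"] \<delta> K'0 unfolding Z_def by (intro add_left_mono mult_left_mono) auto
    also have "\<dots> \<le> e * \<delta>"
    proof -
      have "\<delta> \<le> e / (4 * K' * C + 1)" using \<delta> by (simp add: d0_def)
      then have "(4 * K' * C + 1) * \<delta> \<le> e"
        using \<open>0 \<le> 4 * K' * C\<close> by (simp add: field_simps)
      then have "K' * (C * (2 * \<delta>)) \<le> e / 2" using \<delta> by (simp add: algebra_simps)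
      then have "K' * (C * (2 * \<delta>)) * \<delta> \<le> e / 2 * \<delta>" using \<delta> by (intro mult_right_mono) auto
      then show ?thesis by (simp add: algebra_simps)
    qed
    finally show ?thesis by (simp add: \<delta>_def)
  qed simp
  ultimately show "\<exists>d>0. \<forall>x'. norm (x' - x) < d \<longrightarrow> norm (?f x' - ?f x - ?f' (x' - x)) \<le> e * norm (x' - x)"
    by blast
qed

text \<open>With \<open>x\<close> held fixed, the performance difference writes the cost of
  \<open>x'\<close> as a constant plus the period terms of \<open>period_has_derivative\<close>, so
  cost-to-go functions are never differentiated in the policy. Reindexing by \<open>tm\<close> turns
  the double sum into an inner product.\<close>

lemma total_cost_gderiv:
  fixes x :: "real^'i^'t::finite" and tm :: "nat \<Rightarrow> 't"
  defines "lev \<equiv> \<lambda>(x :: real^'i^'t) t i. x $ tm t $ i"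
  assumes tm: "bij_betw tm {1..T} UNIV"
    and G: "\<And>t i. t \<in> {1..T} \<Longrightarrow> G $ tm t $ i = order_prob (lev x) t i * order_slope (lev x) t (lev x t i) i"
  shows "GDERIV (\<lambda>x. total_cost (lev x)) x :> G"
proof -
  \<comment> \<open>The type of block labels is nonempty, so its bijection with the periods forces
    at least one period.\<close>
  have "1 \<le> T" using tm by (cases T) (auto simp: bij_betw_def)
  define f where "f t x' = expectation (\<lambda>\<omega>. order_cost (lev x) t (max (stock (lev x') t \<omega>) (lev x' t (S t \<omega>))) (S t \<omega>)
       - order_cost (lev x) t (max (stock (lev x') t \<omega>) (lev x t (S t \<omega>))) (S t \<omega>))" for t x'
  have "((\<lambda>x'. total_cost (lev x) + (\<Sum>t = 1..T. f t x')) has_derivative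
      (\<lambda>v. 0 + (\<Sum>t = 1..T. \<Sum>i\<in>UNIV. order_prob (lev x) t i * order_slope (lev x) t (lev x t i) i * v $ tm t $ i))) (at x)"
    unfolding f_def lev_def
    by (intro has_derivative_add has_derivative_sum has_derivative_const period_has_derivative)
  moreover have "total_cost (lev x) + (\<Sum>t = 1..T. f t x') = total_cost (lev x')" for x'
    using performance_difference[OF \<open>1 \<le> T\<close>, of "lev x'" "lev x"] by (simp add: f_def)
  moreover have "0 + (\<Sum>t = 1..T. \<Sum>i\<in>UNIV. order_prob (lev x) t i * order_slope (lev x) t (lev x t i) i * v $ tm t $ i) = v \<bullet> G" for v
  proof -
    have "v \<bullet> G = (\<Sum>\<tau>\<in>UNIV. \<Sum>i\<in>UNIV. v $ \<tau> $ i * G $ \<tau> $ i)"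
      by (simp add: inner_vec_def)
    also have "\<dots> = (\<Sum>t = 1..T. \<Sum>i\<in>UNIV. v $ tm t $ i * G $ tm t $ i)"
      by (rule sum.reindex_bij_betw[OF tm, symmetric])
    also have "\<dots> = (\<Sum>t = 1..T. \<Sum>i\<in>UNIV. order_prob (lev x) t i * order_slope (lev x) t (lev x t i) i * v $ tm t $ i)"
      by (intro sum.cong refl) (simp add: G mult_ac)
    finally show ?thesis by simp
  qed
  ultimately show ?thesis unfolding gderiv_def by simp
qed

section \<open>The optimality gap\<close>

text \<open>Integration of the density bound. As the stage slope is \<open>h t + b t\<close> times
  the CDF minus a constant, this is the source of the growth rate
  \<open>(h t + b t) * \<mu>\<^sub>D\<close>.\<close>

lemma cdf_growth:
  assumes "0 \<le> y" "y \<le> y'" "y' \<le> B"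
  shows "\<mu>\<^sub>D * (y' - y) \<le> cdf (dem i) y' - cdf (dem i) y"
proof (cases "y = y'")
  case False
  interpret N: real_distribution "dem i" by (rule demand_law)
  obtain q where [measurable]: "q \<in> borel_measurable lborel" and q: "\<And>d. 0 \<le> q d"
    "dem i = density lborel (\<lambda>d. ennreal (q d))" "\<And>d. d \<in> {0..B} \<Longrightarrow> \<mu>\<^sub>D \<le> q d"
    using dem_density[of i] by auto
  have "ennreal (\<mu>\<^sub>D * (y' - y)) = (\<integral>\<^sup>+d. ennreal \<mu>\<^sub>D * indicator {y<..y'} d \<partial>lborel)"
    using assms \<mu>\<^sub>D_pos by (simp add: nn_integral_cmult ennreal_mult')
  also have "\<dots> \<le> (\<integral>\<^sup>+d. ennreal (q d) * indicator {y<..y'} d \<partial>lborel)"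
    using assms q(3) by (intro nn_integral_mono) (auto simp: indicator_def intro!: ennreal_leI)
  also have "\<dots> = emeasure (dem i) {y<..y'}" by (simp add: q(2) emeasure_density)
  also have "\<dots> = ennreal (cdf (dem i) y' - cdf (dem i) y)"
    using False assms by (subst N.cdf_diff_eq) (auto simp: N.emeasure_eq_measure)
  finally show ?thesis
    using N.cdf_nondecreasing[OF assms(2)] by (simp add: ennreal_le_iff)
qed simp

text \<open>Writing \<open>u\<^sub>s\<close> for a bound on the downward slope at the interior base-stock levels of period \<open>s\<close>, the
  slope of the cost-to-go is nondecreasing up to an error that accumulates additively over periods.\<close>

lemma
  fixes u :: "nat \<Rightarrow> real"
  assumes u0: "\<And>t. 0 \<le> u t"
    and u: "\<And>t i. t \<in> {1..T} \<Longrightarrow> \<theta> t i < B \<Longrightarrow> - u t \<le> order_slope \<theta> t (\<theta> t i) i"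
  shows slope_to_go_near_mono: "\<And>t x x' i. 1 \<le> t \<Longrightarrow> t \<le> Suc T \<Longrightarrow> x \<le> x' \<Longrightarrow> x' \<le> B \<Longrightarrow>
      slope_to_go \<theta> t x i - sum u {t..T} \<le> slope_to_go \<theta> t x' i"
    and order_slope_near_mono: "\<And>t y y' i. t \<in> {1..T} \<Longrightarrow> y \<le> y' \<Longrightarrow> y' \<le> B \<Longrightarrow>
      order_slope \<theta> t y i + (h t + b t) * (cdf (dem i) y' - cdf (dem i) y) - sum u {Suc t..T} \<le> order_slope \<theta> t y' i"
proof -
  \<comment> \<open>One period of the backward induction. Since demand is nonnegative,
    \<open>y' - d\<close> stays below \<open>B\<close>, and averaging over demand and next state
    does not enlarge the accumulated error.\<close>
  have order: "order_slope \<theta> t y i + (h t + b t) * (cdf (dem i) y' - cdf (dem i) y) - sum u {Suc t..T} \<le> order_slope \<theta> t y' i"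
    if t: "t \<in> {1..T}" and y: "y \<le> y'" "y' \<le> B"
      and IH: "\<And>x x' j. x \<le> x' \<Longrightarrow> x' \<le> B \<Longrightarrow> slope_to_go \<theta> (Suc t) x j - sum u {Suc t..T} \<le> slope_to_go \<theta> (Suc t) x' j"
    for t y y' i
  proof -
    interpret N: real_distribution "dem i" by (rule demand_law)
    let ?w = "sum u {Suc t..T}"
    have int: "integrable (dem i) (\<lambda>d. slope_to_go \<theta> (Suc t) (z - d) j)" for z j
      using slope_to_go_integrable[where \<theta>=\<theta> and t=t] t by auto
    have "(\<integral>d. slope_to_go \<theta> (Suc t) (y - d) j \<partial>dem i) - ?w \<le> (\<integral>d. slope_to_go \<theta> (Suc t) (y' - d) j \<partial>dem i)" for j
    proof -
      have "AE d in dem i. slope_to_go \<theta> (Suc t) (y - d) j - ?w \<le> slope_to_go \<theta> (Suc t) (y' - d) j"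
        using demand_nonneg[of i] by eventually_elim (use y in \<open>intro IH; simp\<close>)
      then have "(\<integral>d. slope_to_go \<theta> (Suc t) (y - d) j - ?w \<partial>dem i) \<le> (\<integral>d. slope_to_go \<theta> (Suc t) (y' - d) j \<partial>dem i)"
        using int by (intro integral_mono_AE) auto
      then show ?thesis using int measure_dem_UNIV[of i] by simp
    qed
    then have "(\<Sum>j\<in>UNIV. pmf (p i) j * ((\<integral>d. slope_to_go \<theta> (Suc t) (y - d) j \<partial>dem i) - ?w))
      \<le> (\<Sum>j\<in>UNIV. pmf (p i) j * (\<integral>d. slope_to_go \<theta> (Suc t) (y' - d) j \<partial>dem i))"
      by (intro sum_mono mult_left_mono) auto
    then show ?thesis
      by (simp add: order_slope_def right_diff_distrib sum_subtractf sum_distrib_right[symmetric] sum_pmf_eq_1)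
  qed
  have hb: "0 \<le> (h t + b t) * (cdf (dem i) y' - cdf (dem i) y)" if "t \<in> {1..T}" "y \<le> y'" for t y y' i
  proof -
    interpret N: real_distribution "dem i" by (rule demand_law)
    show ?thesis using cost_pos[OF that(1)] N.cdf_nondecreasing[OF that(2)] by simp
  qed
  show slope: "slope_to_go \<theta> t x i - sum u {t..T} \<le> slope_to_go \<theta> t x' i"
    if "1 \<le> t" "t \<le> Suc T" "x \<le> x'" "x' \<le> B" for t x x' i
    using that(2,1,3,4)
  proof (induction t arbitrary: x x' i rule: inc_induct)
    case base
    then show ?case by (simp add: to_go_end)
  next
    case (step t)
    then have t: "t \<in> {1..T}" by auto
    note IH = step.IH[OF le_SucI[OF step.prems(1)]]
    have w: "sum u {t..T} = u t + sum u {Suc t..T}" using t by (simp add: sum.atLeast_Suc_atMost)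
    have w0: "0 \<le> sum u {Suc t..T}" using u0 by (intro sum_nonneg) auto
    \<comment> \<open>In the first case both slopes are 0. In the second the slope jumps at the
      level, down by at most \<open>u t\<close>; that bound applies because the level lies below
      \<open>x' \<le> B\<close>. In the third no level is crossed.\<close>
    consider "x' \<le> \<theta> t i" | "x \<le> \<theta> t i" "\<theta> t i < x'" | "\<theta> t i < x" by linarith
    then show ?case
    proof cases
      case 1
      then show ?thesis using t step.prems u0[of t] w w0 by (simp add: slope_to_go_eq)
    next
      case 2
      have "order_slope \<theta> t (\<theta> t i) i - sum u {Suc t..T} \<le> order_slope \<theta> t x' i"
        using order[OF t _ _ IH, of "\<theta> t i" x' i] hb[OF t, of "\<theta> t i" x' i] 2 step.prems by simp
      moreover have "- u t \<le> order_slope \<theta> t (\<theta> t i) i" using u[OF t, of i] 2 step.prems by simp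
      ultimately show ?thesis using t 2 w by (simp add: slope_to_go_eq)
    next
      case 3
      have "order_slope \<theta> t x i - sum u {Suc t..T} \<le> order_slope \<theta> t x' i"
        using order[OF t _ _ IH, of x x' i] hb[OF t, of x x' i] step.prems by simp
      then show ?thesis using t 3 w step.prems u0[of t] by (simp add: slope_to_go_eq)
    qed
  qed
  show "order_slope \<theta> t y i + (h t + b t) * (cdf (dem i) y' - cdf (dem i) y) - sum u {Suc t..T} \<le> order_slope \<theta> t y' i"
    if "t \<in> {1..T}" "y \<le> y'" "y' \<le> B" for t y y' i
    using that by (intro order slope) auto
qed

text \<open>Along the path of \<open>\<theta>'\<close>, each term of the performance difference
  compares two order-up-to points for one inventory below \<open>B\<close>, and the descent lemmas
  bound it by the squared total of the errors over \<open>2 * c\<close>. Slope bounds are required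
  only in directions that stay in the box, which is all that a normal cone can provide.\<close>

lemma total_cost_gap:
  fixes u :: "nat \<Rightarrow> real"
  assumes "1 \<le> T" "0 < c" and c: "\<And>t. t \<in> {1..T} \<Longrightarrow> c \<le> (h t + b t) * \<mu>\<^sub>D"
    and \<theta>: "\<And>t i. t \<in> {1..T} \<Longrightarrow> \<theta> t i \<in> {0..B}" and \<theta>': "\<And>t i. t \<in> {1..T} \<Longrightarrow> \<theta>' t i \<in> {0..B}"
    and u0: "\<And>t. 0 \<le> u t"
    and u_right: "\<And>t i. t \<in> {1..T} \<Longrightarrow> \<theta> t i < B \<Longrightarrow> - u t \<le> order_slope \<theta> t (\<theta> t i) i"
    and u_left: "\<And>t i. t \<in> {1..T} \<Longrightarrow> 0 < \<theta> t i \<Longrightarrow> order_slope \<theta> t (\<theta> t i) i \<le> u t"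
  shows "total_cost \<theta> - total_cost \<theta>' \<le> real T * (sum u {1..T})\<^sup>2 / (2 * c)"
proof -
  let ?W = "sum u {1..T}"
  have slope: "order_slope \<theta> t y i + c * (y' - y) - sum u {Suc t..T} \<le> order_slope \<theta> t y' i"
    if t: "t \<in> {1..T}" and y: "0 \<le> y" "y \<le> y'" "y' \<le> B" for t y y' i
  proof -
    have "c * (y' - y) \<le> (h t + b t) * \<mu>\<^sub>D * (y' - y)"
      using c[OF t] y by (intro mult_right_mono) auto
    also have "\<dots> = (h t + b t) * (\<mu>\<^sub>D * (y' - y))" by simp
    also have "\<dots> \<le> (h t + b t) * (cdf (dem i) y' - cdf (dem i) y)"
      using cdf_growth[OF y, of i] cost_pos[OF t] by (intro mult_left_mono) auto
    finally show ?thesis using order_slope_near_mono[OF u0 u_right t y(2,3), of i] by simp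
  qed
  have period: "order_cost \<theta> t (max x (\<theta> t i)) i - order_cost \<theta> t (max x (\<theta>' t i)) i \<le> ?W\<^sup>2 / (2 * c)"
    if t: "t \<in> {1..T}" and x: "x \<le> B" for t i x
  proof -
    have reg: "((\<lambda>y. order_cost \<theta> t y i) has_real_derivative order_slope \<theta> t z i) (at z)" for z
      using order_cost_deriv[of t \<theta>] t by auto
    have W: "u t + sum u {Suc t..T} \<le> ?W" "0 \<le> ?W"
    proof -
      have "sum u {t..T} \<le> ?W" using u0 t by (intro sum_mono2) auto
      then show "u t + sum u {Suc t..T} \<le> ?W" using t by (simp add: sum.atLeast_Suc_atMost)
    qed (use u0 in \<open>auto intro: sum_nonneg\<close>)
    have \<theta>t: "0 \<le> \<theta> t i" "\<theta> t i \<le> B" "0 \<le> \<theta>' t i" "\<theta>' t i \<le> B" using \<theta>[OF t, of i] \<theta>'[OF t, of i] by auto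
    \<comment> \<open>A move to the right may start at an inventory above the level, so the level
      serves as separate reference point. A move to the left always starts at the level, because
      \<open>x\<close> is then below it.\<close>
    consider "max x (\<theta>' t i) = max x (\<theta> t i)" | "max x (\<theta> t i) < max x (\<theta>' t i)" | "max x (\<theta>' t i) < max x (\<theta> t i)"
      by linarith
    then show ?thesis
    proof cases
      case 1
      then show ?thesis using \<open>0 < c\<close> by simp
    next
      case 2
      then have "\<theta> t i < B" using \<theta>t x by auto
      show ?thesis
      proof (rule descent_right[OF reg \<open>0 < c\<close>, where ?y0.0="\<theta> t i"])
        fix z assume "\<theta> t i \<le> z" "z \<le> max x (\<theta>' t i)"
        moreover from this have "z \<le> B" using \<theta>t x by (auto simp: max_def split: if_splits)
        ultimately show "c * (z - \<theta> t i) - ?W \<le> order_slope \<theta> t z i"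
          using slope[OF t, of "\<theta> t i" z i] u_right[OF t \<open>\<theta> t i < B\<close>] W \<theta>t x by auto
      qed (use 2 in auto)
    next
      case 3
      then have eq: "max x (\<theta> t i) = \<theta> t i" and pos: "0 < \<theta> t i" using \<theta>t by (auto simp: max_def split: if_splits)
      show ?thesis unfolding eq
      proof (rule descent_left[OF reg \<open>0 < c\<close>])
        fix z assume "max x (\<theta>' t i) \<le> z" "z \<le> \<theta> t i"
        then show "order_slope \<theta> t z i \<le> ?W - c * (\<theta> t i - z)"
          using slope[OF t, of z "\<theta> t i" i] u_left[OF t pos] W \<theta>t by auto
      qed (use 3 eq in auto)
    qed
  qed
  have "total_cost \<theta> - total_cost \<theta>' = (\<Sum>t = 1..T.
      expectation (\<lambda>\<omega>. order_cost \<theta> t (max (stock \<theta>' t \<omega>) (\<theta> t (S t \<omega>))) (S t \<omega>)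
        - order_cost \<theta> t (max (stock \<theta>' t \<omega>) (\<theta>' t (S t \<omega>))) (S t \<omega>)))"
  proof -
    have "expectation (\<lambda>\<omega>. order_cost \<theta> t (max (stock \<theta>' t \<omega>) (\<theta> t (S t \<omega>))) (S t \<omega>)
        - order_cost \<theta> t (max (stock \<theta>' t \<omega>) (\<theta>' t (S t \<omega>))) (S t \<omega>))
      = - expectation (\<lambda>\<omega>. order_cost \<theta> t (max (stock \<theta>' t \<omega>) (\<theta>' t (S t \<omega>))) (S t \<omega>)
        - order_cost \<theta> t (max (stock \<theta>' t \<omega>) (\<theta> t (S t \<omega>))) (S t \<omega>))" for t
      by (subst integral_minus[symmetric]) simp
    then show ?thesis
      using performance_difference[OF \<open>1 \<le> T\<close>, of \<theta>' \<theta>] by (simp add: sum_negf)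
  qed
  also have "\<dots> \<le> (\<Sum>t = 1..T. ?W\<^sup>2 / (2 * c))"
  proof (rule sum_mono)
    fix t assume t: "t \<in> {1..T}"
    have AE: "AE \<omega> in M. stock \<theta>' t \<omega> \<le> B" using t \<theta>' by (intro AE_stock_le) auto
    have "expectation (\<lambda>\<omega>. order_cost \<theta> t (max (stock \<theta>' t \<omega>) (\<theta> t (S t \<omega>))) (S t \<omega>)
        - order_cost \<theta> t (max (stock \<theta>' t \<omega>) (\<theta>' t (S t \<omega>))) (S t \<omega>)) \<le> expectation (\<lambda>\<omega>. ?W\<^sup>2 / (2 * c))"
    proof (rule integral_mono_AE)
      show "AE \<omega> in M. order_cost \<theta> t (max (stock \<theta>' t \<omega>) (\<theta> t (S t \<omega>))) (S t \<omega>)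
        - order_cost \<theta> t (max (stock \<theta>' t \<omega>) (\<theta>' t (S t \<omega>))) (S t \<omega>) \<le> ?W\<^sup>2 / (2 * c)"
        using AE by eventually_elim (rule period[OF t])
    qed (use t in \<open>auto intro!: Bochner_Integration.integrable_diff order_cost_integrable\<close>)
    then show "expectation (\<lambda>\<omega>. order_cost \<theta> t (max (stock \<theta>' t \<omega>) (\<theta> t (S t \<omega>))) (S t \<omega>)
        - order_cost \<theta> t (max (stock \<theta>' t \<omega>) (\<theta>' t (S t \<omega>))) (S t \<omega>)) \<le> ?W\<^sup>2 / (2 * c)"
      by (simp add: prob_space)
  qed
  finally show ?thesis by simp
qed

text \<open>Dividing by the order probability, at least \<open>\<alpha> * N\<close>, turns gradient
  entries into slopes. The entries of \<open>n\<close> have a favourable sign: nonpositive where the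
  level can rise, nonnegative where it can fall. A slope that promises descent is therefore
  controlled by the entry of \<open>G + n\<close> alone.\<close>

lemma total_cost_gap_gradient:
  fixes x x' G n :: "real^'i^'t::finite" and tm :: "nat \<Rightarrow> 't"
  defines "lev \<equiv> \<lambda>(x :: real^'i^'t) t i. x $ tm t $ i"
  assumes tm: "bij_betw tm {1..T} UNIV"
    and x: "x \<in> base_stock_set B" "x' \<in> base_stock_set B"
    and G: "\<And>t i. t \<in> {1..T} \<Longrightarrow> G $ tm t $ i = order_prob (lev x) t i * order_slope (lev x) t (lev x t i) i"
    and n: "n \<in> normal_cone (base_stock_set B) x"
    and m: "0 < m" "\<And>t. t \<in> {1..T} \<Longrightarrow> m \<le> h t + b t" and N: "0 < N" "\<And>i. N \<le> pmf \<nu> i"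
  shows "total_cost (lev x) - total_cost (lev x') \<le> (real T)\<^sup>2 / (2 * m * \<mu>\<^sub>D * \<alpha>\<^sup>2 * N\<^sup>2) * (norm (G + n))\<^sup>2"
proof -
  have "1 \<le> T" using tm by (cases T) (auto simp: bij_betw_def)
  define v where "v = G + n"
  \<comment> \<open>The norm of the whole block is taken so that one number per period serves all
    states.\<close>
  define u where "u t = norm (v $ tm t) / (\<alpha> * N)" for t
  have lev: "lev x t i \<in> {0..B}" "lev x' t i \<in> {0..B}" for t i
    using x by (auto simp: lev_def base_stock_set_def)
  have N\<alpha>: "0 < \<alpha> * N" using \<alpha>_pos N by simp
  have P: "\<alpha> * N \<le> order_prob (lev x) t i" if "t \<in> {1..T}" for t i
    using order_prob_ge[OF that, of "lev x" i] lev N(2)[of i] \<alpha>_pos by (meson mult_left_mono order_trans less_imp_le)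
  have steep: "s \<le> u t" if "t \<in> {1..T}" "order_prob (lev x) t i * s \<le> \<bar>v $ tm t $ i\<bar>" for t i s
  proof (cases "0 \<le> s")
    case True
    have "\<alpha> * N * s \<le> order_prob (lev x) t i * s" using P[OF that(1)] True by (rule mult_right_mono)
    also have "\<dots> \<le> \<bar>v $ tm t $ i\<bar>" by (rule that(2))
    also have "\<dots> \<le> norm (v $ tm t)" by (rule component_le_norm_cart)
    finally show ?thesis using N\<alpha> by (simp add: u_def pos_le_divide_eq mult.commute)
  next
    case False
    moreover have "0 \<le> u t" using N\<alpha> by (simp add: u_def)
    ultimately show ?thesis by simp
  qed
  have "total_cost (lev x) - total_cost (lev x') \<le> real T * (sum u {1..T})\<^sup>2 / (2 * (m * \<mu>\<^sub>D))"
  proof (rule total_cost_gap[OF \<open>1 \<le> T\<close>])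
    show "m * \<mu>\<^sub>D \<le> (h t + b t) * \<mu>\<^sub>D" if "t \<in> {1..T}" for t
      using m(2)[OF that] \<mu>\<^sub>D_pos by (intro mult_right_mono) auto
    fix t i assume t: "t \<in> {1..T}"
    let ?s = "order_slope (lev x) t (lev x t i) i"
    have v: "v $ tm t $ i = order_prob (lev x) t i * ?s + n $ tm t $ i" using G[OF t, of i] by (simp add: v_def)
    show "- u t \<le> ?s" if "lev x t i < B"
    proof -
      have "n $ tm t $ i \<le> 0" using normal_cone_base_stock_sign(1)[OF n x(1)] that by (simp add: lev_def)
      then have "order_prob (lev x) t i * (- ?s) \<le> \<bar>v $ tm t $ i\<bar>" using v by simp
      from steep[OF t this] show ?thesis by simp
    qed
    show "?s \<le> u t" if "0 < lev x t i"
    proof -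
      have "0 \<le> n $ tm t $ i" using normal_cone_base_stock_sign(2)[OF n x(1)] that by (simp add: lev_def)
      then have "order_prob (lev x) t i * ?s \<le> \<bar>v $ tm t $ i\<bar>" using v by simp
      from steep[OF t this] show ?thesis .
    qed
  qed (use m(1) \<mu>\<^sub>D_pos lev N\<alpha> in \<open>auto simp: u_def\<close>)
  also have "\<dots> \<le> real T * (real T * (norm v)\<^sup>2 / (\<alpha> * N)\<^sup>2) / (2 * (m * \<mu>\<^sub>D))"
  proof (intro divide_right_mono mult_left_mono)
    \<comment> \<open>Cauchy-Schwarz over the periods gives one factor \<open>T\<close>; the other
      stems from adding the period terms in \<open>total_cost_gap\<close>.\<close>
    have "(sum u {1..T})\<^sup>2 \<le> (\<Sum>t\<in>{1..T}. (u t)\<^sup>2) * real (card {1..T})"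
      by (rule sum_squared_le_sum_of_squares)
    also have "(\<Sum>t\<in>{1..T}. (u t)\<^sup>2) = (\<Sum>t\<in>{1..T}. (norm (v $ tm t))\<^sup>2) / (\<alpha> * N)\<^sup>2"
      by (simp add: u_def power_divide sum_divide_distrib)
    also have "(\<Sum>t\<in>{1..T}. (norm (v $ tm t))\<^sup>2) = (\<Sum>\<tau>\<in>UNIV. (norm (v $ \<tau>))\<^sup>2)"
      by (rule sum.reindex_bij_betw[OF tm])
    also have "\<dots> = (norm v)\<^sup>2"
      by (simp add: norm_vec_def L2_set_def sum_nonneg)
    finally show "(sum u {1..T})\<^sup>2 \<le> real T * (norm v)\<^sup>2 / (\<alpha> * N)\<^sup>2" by (simp add: mult.commute)
  qed (use m \<mu>\<^sub>D_pos in auto)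
  also have "\<dots> = (real T)\<^sup>2 / (2 * m * \<mu>\<^sub>D * \<alpha>\<^sup>2 * N\<^sup>2) * (norm v)\<^sup>2"
    by (simp add: power2_eq_square field_simps)
  finally show ?thesis by (simp add: v_def)
qed

section \<open>Comparison of the constants\<close>

lemma L\<^sub>D_pos: "0 < L\<^sub>D"
proof (rule ccontr)
  interpret N: real_distribution "dem k" for k by (rule demand_law)
  assume "\<not> 0 < L\<^sub>D"
  then have "L\<^sub>D = 0" using lipschitz_on_nonneg[OF dem_lipschitz] by simp
  then have "cdf (dem i) x = cdf (dem i) 0" for i x
    using lipschitz_onD[OF dem_lipschitz[of i], of x 0] by simp
  then have "cdf (dem i) = (\<lambda>_. cdf (dem i) 0)" for i by (rule ext)
  then show False
    using N.cdf_lim_at_bot[of undefined] N.cdf_lim_at_top_prob[of undefined]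
    by (metis tendsto_const_iff trivial_limit_at_bot_linorder trivial_limit_at_top_linorder zero_neq_one)
qed

text \<open>Both rates bound the growth of the same CDF over the interval from 0 to
  \<open>B\<close>, one from below and one from above.\<close>

lemma \<mu>\<^sub>D_le_L\<^sub>D: "0 < B \<Longrightarrow> \<mu>\<^sub>D \<le> L\<^sub>D"
proof -
  assume "0 < B"
  have "\<mu>\<^sub>D * B \<le> cdf (dem undefined) B - cdf (dem undefined) 0"
    using cdf_growth[of 0 B] \<open>0 < B\<close> by simp
  also have "\<dots> \<le> L\<^sub>D * B"
    using lipschitz_onD[OF dem_lipschitz, of B 0 undefined] \<open>0 < B\<close> by (simp add: dist_real_def)
  finally show ?thesis using \<open>0 < B\<close> by simp
qed

text \<open>In the last period an optimal level is a critical quantile of the demand, which lies below \<open>B\<close>.\<close>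

lemma holding_cost_ge:
  assumes "1 \<le> T" "y \<le> B" and min: "\<And>z. opt_cost_to_go T h b p dem T y i \<le> opt_cost_to_go T h b p dem T z i"
  shows "\<alpha> * (h T + b T) \<le> h T"
proof -
  interpret N: real_distribution "dem i" by (rule demand_law)
  have T: "T \<in> {1..T}" using assms by simp
  have "opt_cost_to_go T h b p dem T z i = stage_cost h b dem T z i" for z
    by (simp add: opt_cost_to_go_def opt_value.simps)
  then have "stage_cost h b dem T y i \<le> stage_cost h b dem T z i" for z using min by simp
  then have "(h T + b T) * cdf (dem i) y - b T = 0"
    \<comment> \<open>Minimality is over the whole line, so the derivative vanishes even if
      \<open>y\<close> is an endpoint of the box.\<close>
    using DERIV_local_min[OF stage_cost_regular(2)[OF T], of 1 y i] by auto
  moreover have "(h T + b T) * cdf (dem i) y \<le> (h T + b T) * (1 - \<alpha>)"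
    using N.cdf_nondecreasing[OF \<open>y \<le> B\<close>] dem_le[of i] cost_pos[OF T] by (intro mult_left_mono) linarith+
  ultimately show ?thesis by (simp add: algebra_simps)
qed

end

text \<open>The constant on the right divided by the one on the left, as PLK constants, is
  \<open>m\<^sup>2 * \<mu>\<^sup>2 * \<alpha>^6 * N / (exp 1 * L\<^sup>2 * C\<^sup>2 *
  t\<^sup>2)\<close>, which \<open>key\<close> bounds by 1.\<close>

lemma plk_constant_le:
  fixes m \<mu> \<alpha> N L C t :: real
  assumes pos: "0 < m" "0 < \<mu>" "0 < \<alpha>" "0 < N" "0 < L" "1 \<le> t"
    and le: "\<alpha> \<le> 1" "N \<le> 1" "\<mu> \<le> L" "\<alpha> * m \<le> C"
  shows "t\<^sup>2 / (2 * m * \<mu> * \<alpha>\<^sup>2 * N\<^sup>2) \<le> 1 / (2 * (m^3 * \<mu>^3 * \<alpha>^8 * N^3 / (exp 1 * L\<^sup>2 * C\<^sup>2 * t^4)))"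
proof -
  have C: "0 < C" using le(4) pos by (meson less_le_trans mult_pos_pos)
  \<comment> \<open>Two of the six factors \<alpha> go with \<open>m\<close> into
    \<open>\<alpha> * m \<le> C\<close>; the other four and \<open>N\<close> are bounded by
    1.\<close>
  have "m\<^sup>2 * \<mu>\<^sup>2 * \<alpha>^6 * N = (\<alpha> * m)\<^sup>2 * \<mu>\<^sup>2 * (\<alpha>^4 * N)" by (simp add: power_mult_distrib eval_nat_numeral)
  also have "\<dots> \<le> C\<^sup>2 * L\<^sup>2 * (1 * 1)"
    using pos le by (intro mult_mono power_mono power_le_one) auto
  also have "\<dots> \<le> C\<^sup>2 * L\<^sup>2 * (exp 1 * t\<^sup>2)"
  proof (rule mult_left_mono)
    show "1 * 1 \<le> exp 1 * t\<^sup>2" using pos by (intro mult_mono) (auto simp: one_le_power)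
  qed auto
  finally have key: "m\<^sup>2 * \<mu>\<^sup>2 * \<alpha>^6 * N \<le> exp 1 * L\<^sup>2 * C\<^sup>2 * t\<^sup>2" by (simp add: mult_ac)
  have "t\<^sup>2 / (2 * m * \<mu> * \<alpha>\<^sup>2 * N\<^sup>2) = t\<^sup>2 * (m\<^sup>2 * \<mu>\<^sup>2 * \<alpha>^6 * N) / (2 * (m^3 * \<mu>^3 * \<alpha>^8 * N^3))"
    using pos by (simp add: field_simps eval_nat_numeral)
  also have "\<dots> \<le> t\<^sup>2 * (exp 1 * L\<^sup>2 * C\<^sup>2 * t\<^sup>2) / (2 * (m^3 * \<mu>^3 * \<alpha>^8 * N^3))"
    using key pos by (intro divide_right_mono mult_left_mono) auto
  also have "\<dots> = 1 / (2 * (m^3 * \<mu>^3 * \<alpha>^8 * N^3 / (exp 1 * L\<^sup>2 * C\<^sup>2 * t^4)))"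
    using pos C by (simp add: field_simps eval_nat_numeral)
  finally show ?thesis .
qed

theorem theorem4:
  fixes T :: nat and tm :: "nat \<Rightarrow> 't::finite"
    and B \<alpha> L\<^sub>\<rho> L\<^sub>D \<mu>\<^sub>D :: real
    and h b :: "nat \<Rightarrow> real"
    and \<nu> :: "'i::finite pmf" and p :: "'i \<Rightarrow> 'i pmf"
    and \<rho> :: "real \<Rightarrow> real" and dem :: "'i \<Rightarrow> real measure"
    and M :: "'w measure"
    and X1 :: "'w \<Rightarrow> real" and S :: "nat \<Rightarrow> 'w \<Rightarrow> 'i" and D :: "nat \<Rightarrow> 'w \<Rightarrow> real"
    and \<theta>opt :: "real^'i^'t"
  assumes periods: "bij_betw tm {1..T} UNIV"
    and B_nonneg: "0 \<le> B"
    and cost_nonneg: "\<And>t. t \<in> {1..T} \<Longrightarrow> 0 \<le> h t \<and> 0 \<le> b t"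
    and cost_pos: "\<And>t. t \<in> {1..T} \<Longrightarrow> 0 < h t + b t"
    and stationary: "bind_pmf \<nu> p = \<nu>"
    and \<nu>_pos: "\<And>i. 0 < pmf \<nu> i"
    and demand_law: "\<And>i. real_distribution (dem i)"
    and demand_nonneg: "\<And>i. AE d in dem i. 0 \<le> d"
    and cost_finite: "\<And>t i y. t \<in> {1..T} \<Longrightarrow>
          integrable (dem i) (\<lambda>d. h t * max (y - d) 0 + b t * max (- (y - d)) 0)"
    and prob_space: "prob_space M"
    and X1_measurable: "X1 \<in> borel_measurable M"
    and S_measurable: "\<And>t. t \<in> {1..T} \<Longrightarrow> S t \<in> measurable M (count_space UNIV)"
    and D_measurable: "\<And>t. t \<in> {1..T} \<Longrightarrow> D t \<in> borel_measurable M"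
    and X1_cdf: "cdf (distr M borel X1) = \<rho>"
    and X1_le: "AE \<omega> in M. X1 \<omega> \<le> B"
    and chain: "\<And>s. measure M {\<omega> \<in> space M. \<forall>t\<in>{1..T}. S t \<omega> = s t} =
          pmf \<nu> (s 1) * (\<Prod>t\<in>{1..<T}. pmf (p (s t)) (s (Suc t)))"
    and demands_given_chain: "\<And>s A. (\<And>t. t \<in> {1..T} \<Longrightarrow> A t \<in> sets borel) \<Longrightarrow>
          measure M {\<omega> \<in> space M. \<forall>t\<in>{1..T}. S t \<omega> = s t \<and> D t \<omega> \<in> A t} =
          measure M {\<omega> \<in> space M. \<forall>t\<in>{1..T}. S t \<omega> = s t} *
          (\<Prod>t\<in>{1..T}. measure (dem (s t)) (A t))"
    and A1: "prob_space.indep_set M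
          (sets (vimage_algebra (space M) X1 borel))
          (sets (vimage_algebra (space M) (\<lambda>\<omega>. \<lambda>t\<in>{1..T}. (S t \<omega>, D t \<omega>))
             (PiM {1..T} (\<lambda>_. count_space UNIV \<Otimes>\<^sub>M borel))))"
    and A2: "L\<^sub>\<rho>-lipschitz_on UNIV \<rho>" "\<And>i. L\<^sub>D-lipschitz_on UNIV (cdf (dem i))"
    and A3: "0 < \<alpha>" "\<alpha> \<le> \<rho> 0" "\<And>i. cdf (dem i) B \<le> 1 - \<alpha>"
    and A4: "0 < \<mu>\<^sub>D" "\<And>i. \<exists>q. q \<in> borel_measurable lborel \<and> (\<forall>d. 0 \<le> q d) \<and>
          dem i = density lborel (\<lambda>d. ennreal (q d)) \<and> (\<forall>d\<in>{0..B}. \<mu>\<^sub>D \<le> q d)"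
    and \<theta>opt_mem: "\<theta>opt \<in> base_stock_set B"
    and \<theta>opt_min: "\<And>t i y. t \<in> {1..T} \<Longrightarrow>
          opt_cost_to_go T h b p dem t (\<theta>opt $ tm t $ i) i \<le> opt_cost_to_go T h b p dem t y i"
  shows "PLK_condition (policy_cost T tm h b dem M X1 S D) (base_stock_set B) \<theta>opt
           ((Min ((\<lambda>t. h t + b t) ` {1..T}))^3 * \<mu>\<^sub>D^3 * \<alpha>^8 * (Min (range (pmf \<nu>)))^3 /
            (exp 1 * L\<^sub>D^2 * (Max ((\<lambda>t. max (h t) (b t)) ` {1..T}))^2 * real T^4))"
proof -
  interpret inventory_model M T B \<alpha> L\<^sub>\<rho> L\<^sub>D \<mu>\<^sub>D h b \<nu> p \<rho> dem X1 S D
    by (rule inventory_model.intro[OF prob_space inventory_model_axioms.intro]) (fact assms)+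
  define lev where "lev = (\<lambda>(x :: real^'i^'t) t i. x $ tm t $ i)"
  define m where "m = Min ((\<lambda>t. h t + b t) ` {1..T})"
  define C where "C = Max ((\<lambda>t. max (h t) (b t)) ` {1..T})"
  define N where "N = Min (range (pmf \<nu>))"
  define \<mu> where "\<mu> = m^3 * \<mu>\<^sub>D^3 * \<alpha>^8 * N^3 / (exp 1 * L\<^sub>D^2 * C^2 * real T^4)"
  have T: "1 \<le> T" using periods by (cases T) (auto simp: bij_betw_def)
  have m: "0 < m" "\<And>t. t \<in> {1..T} \<Longrightarrow> m \<le> h t + b t"
    using T cost_pos by (auto simp: m_def)
  have N: "0 < N" "\<And>i. N \<le> pmf \<nu> i" using \<nu>_pos by (auto simp: N_def)
  have "N \<le> 1" using N(2)[of undefined] pmf_le_1[of \<nu> undefined] by linarith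
  have "\<alpha> \<le> 1"
    using A3(3)[of undefined] measure_nonneg[of "dem undefined" "{..B}"] unfolding cdf_def by linarith
  \<comment> \<open>Optimality of \<open>\<theta>opt\<close> enters here, through the last period;
    \<open>undefined\<close> stands for an arbitrary state.\<close>
  have "\<alpha> * m \<le> \<alpha> * (h T + b T)" using m(2)[of T] T A3(1) by simp
  also have "\<dots> \<le> h T"
    using T \<theta>opt_mem \<theta>opt_min[of T undefined]
    by (intro holding_cost_ge[of "\<theta>opt $ tm T $ undefined" undefined]) (auto simp: base_stock_set_def)
  also have "\<dots> \<le> max (h T) (b T)" by simp
  also have "\<dots> \<le> C" unfolding C_def using T by (intro Max_ge) auto
  finally have "\<alpha> * m \<le> C" .
  then have "0 < C" using m A3(1) by (meson less_le_trans mult_pos_pos)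
  then have "0 < \<mu>" unfolding \<mu>_def using m N A3(1) A4(1) L\<^sub>D_pos T by simp
  have cost: "policy_cost T tm h b dem M X1 S D = (\<lambda>x. total_cost (lev x))"
    by (rule ext) (simp add: policy_cost_def total_cost_def lev_def)
  have "\<exists>G g. GDERIV (\<lambda>x. total_cost (lev x)) x :> G \<and>
        is_arg_min (\<lambda>g. (norm (G + g))\<^sup>2) (\<lambda>g. g \<in> normal_cone (base_stock_set B) x) g \<and>
        total_cost (lev x) - total_cost (lev \<theta>opt) \<le> 1 / (2 * \<mu>) * (norm (G + g))\<^sup>2"
    if x: "x \<in> base_stock_set B" for x
  proof -
    \<comment> \<open>The inverse of the labelling lets the gradient be defined as a vector from
      quantities indexed by periods.\<close>
    define per where "per = the_inv_into {1..T} tm"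
    define G :: "real^'i^'t" where
      "G = (\<chi> \<tau> i. order_prob (lev x) (per \<tau>) i * order_slope (lev x) (per \<tau>) (lev x (per \<tau>) i) i)"
    have G: "G $ tm t $ i = order_prob (lev x) t i * order_slope (lev x) t (lev x t i) i" if "t \<in> {1..T}" for t i
      using that periods by (simp add: G_def per_def the_inv_into_f_f bij_betw_def)
    obtain g where g: "is_arg_min (\<lambda>g. (norm (G + g))\<^sup>2) (\<lambda>g. g \<in> normal_cone (base_stock_set B) x) g"
      by (rule normal_cone_arg_min)
    have "total_cost (lev x) - total_cost (lev \<theta>opt) \<le> 1 / (2 * \<mu>) * (norm (G + g))\<^sup>2"
    \<comment> \<open>For \<open>B = 0\<close> the parameter set is a single point and the gap is 0.
      Otherwise \<open>\<mu>\<^sub>D_le_L\<^sub>D\<close> is available, as the comparison of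
      constants requires.\<close>
    proof (cases "B = 0")
      case True
      then have "x = \<theta>opt" using x \<theta>opt_mem by (auto simp: base_stock_set_def vec_eq_iff)
      then show ?thesis using \<open>0 < \<mu>\<close> by simp
    next
      case False
      have "total_cost (lev x) - total_cost (lev \<theta>opt) \<le> (real T)\<^sup>2 / (2 * m * \<mu>\<^sub>D * \<alpha>\<^sup>2 * N\<^sup>2) * (norm (G + g))\<^sup>2"
        unfolding lev_def
      proof (rule total_cost_gap_gradient[OF periods x \<theta>opt_mem _ _ m N])
        \<comment> \<open>The gap bound holds for every element of the cone, so it may be applied to
          the minimizer.\<close>
        show "g \<in> normal_cone (base_stock_set B) x" using g by (simp add: is_arg_min_def)
      qed (use G in \<open>simp add: lev_def\<close>)
      also have "\<dots> \<le> 1 / (2 * \<mu>) * (norm (G + g))\<^sup>2"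
        unfolding \<mu>_def using False B_nonneg m N A3(1) A4(1) L\<^sub>D_pos T \<mu>\<^sub>D_le_L\<^sub>D
          \<open>\<alpha> \<le> 1\<close> \<open>N \<le> 1\<close> \<open>\<alpha> * m \<le> C\<close>
        by (intro mult_right_mono plk_constant_le) auto
      finally show ?thesis .
    qed
    moreover have "GDERIV (\<lambda>x. total_cost (lev x)) x :> G"
      unfolding lev_def using G by (intro total_cost_gderiv periods) (simp add: lev_def)
    ultimately show ?thesis using g by blast
  qed
  then show ?thesis
    using \<open>0 < \<mu>\<close> unfolding PLK_condition_def cost \<mu>_def m_def C_def N_def by blast
qed

end
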